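(* Let $H$ be a real separable Hilbert space and let $A\colon\mathsf D(A)\subseteq H\to H$ be a linear operator such that $-A$ generates a $C_0$-semigroup $(S(t))_{t\ge0}$ on $H$ which is (uniformly) bounded analytic, and such that $A$ has a bounded inverse. Let $\gamma\in(\tfrac12,\infty)$ and suppose that $$\int_0^\infty\bigl\|t^{\gamma-1}S(t)Q^{\frac12}\bigr\|_{\mathscr L_2(H)}^2\,\mathrm dt<\infty.$$ Let $Z_\gamma=(Z_\gamma(t))_{t\in[0,\infty)}$ be the mild solution to $(\partial_t+A)^\gamma X(t)=\dot W^Q(t)$, $X(0)=0$, on the infinite time interval $[0,\infty)$. If for every $t\in[0,\infty)$ the operator $S(t)$ is self-adjoint and commutes with the covariance operator $Q$ of $W^Q$, then $$\lim_{t\to\infty}Q_{Z_\gamma}(t,t)=\Gamma(\gamma-\tfrac12)\bigl[2\sqrt\pi\,\Gamma(\gamma)\bigr]^{-1}A^{1-2\gamma}Q\quad\text{in }\mathscr L(H).$$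
   Context: $(\Omega,\mathcal F,\mathbb P)$ is a complete probability space with a normal filtration $(\mathcal F_t)_{t\ge0}$; $Q\in\mathscr L(H)$ is self-adjoint and strictly positive, i.e., there exists a constant $\theta\in(0,\infty)$ such that $(Qx,x)_H\ge\theta\|x\|_H^2$ for all $x\in H$; $(W^Q(t))_{t\ge0}$ is an $H$-valued cylindrical $Q$-Wiener process with respect to $(\mathcal F_t)_{t\ge0}$. $\mathscr L_2(H)$ denotes the Hilbert--Schmidt operators. Bounded analytic: the map $t\mapsto S_{\mathbb C}(t)$ (complexification of $S(t)$ on $H_{\mathbb C}$) extends to a bounded holomorphic function on an open sector $\Sigma_\omega=\{\lambda\in\mathbb C\setminus\{0\}:\arg\lambda\in(-\omega,\omega)\}$ for some $\omega\in(0,\pi)$. Under the assumptions $(S(t))_{t\ge0}$ is exponentially stable and $A^{-c}:=\frac1{\Gamma(c)}\int_0^\infty t^{c-1}S(t)\,\mathrm dt$ for $c>0$. Mild solution on $[0,\infty)$: a predictable $H$-valued process $Z_\gamma$ such that for all $t\in[0,\infty)$, $Z_\gamma(t)=\frac1{\Gamma(\gamma)}\int_0^t(t-s)^{\gamma-1}S(t-s)\,\mathrm dW^Q(s)$, $\mathbb P$-a.s. The covariance operators $Q_{Z_\gamma}(s,t)\in\mathscr L(H)$ are defined by $(Q_{Z_\gamma}(s,t)x,y)_H=\mathbb E\bigl[(Z_\gamma(s)-\mathbb E[Z_\gamma(s)],x)_H(Z_\gamma(t)-\mathbb E[Z_\gamma(t)],y)_H\bigr]$ for all $x,y\in H$.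 *)

theory Defs
  imports "HOL-Probability.Probability"
begin

section \<open>Operators on a real Hilbert space\<close>

definition self_adjoint :: "('h::real_inner \<Rightarrow>\<^sub>L 'h) \<Rightarrow> bool" where
  "self_adjoint T \<longleftrightarrow> (\<forall>x y. T x \<bullet> y = x \<bullet> T y)"

definition strictly_positive :: "('h::real_inner \<Rightarrow>\<^sub>L 'h) \<Rightarrow> bool" where
  "strictly_positive T \<longleftrightarrow> (\<exists>\<theta>>0. \<forall>x. T x \<bullet> x \<ge> \<theta> * (norm x)\<^sup>2)"

definition op_sqrt :: "('h::real_inner \<Rightarrow>\<^sub>L 'h) \<Rightarrow> ('h \<Rightarrow>\<^sub>L 'h)" where
  "op_sqrt T = (THE R. self_adjoint R \<and> (\<forall>x. R x \<bullet> x \<ge> 0) \<and> R o\<^sub>L R = T)"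

definition orthonormal_basis :: "'h::real_inner set \<Rightarrow> bool" where
  "orthonormal_basis B \<longleftrightarrow>
     (\<forall>e\<in>B. norm e = 1) \<and> (\<forall>e\<in>B. \<forall>f\<in>B. e \<noteq> f \<longrightarrow> e \<bullet> f = 0) \<and> closure (span B) = UNIV"

text \<open>The squared Hilbert--Schmidt norm, with value \<open>\<infinity>\<close> if the operator is not Hilbert--Schmidt.
  It does not depend on the orthonormal basis that is chosen.\<close>

definition hs_norm_sq :: "('h::real_inner \<Rightarrow>\<^sub>L 'h) \<Rightarrow> ennreal" where
  "hs_norm_sq T =
     (let B = SOME B. orthonormal_basis B
      in \<integral>\<^sup>+ e. ennreal ((norm (T e))\<^sup>2) \<partial>count_space B)"


section \<open>Semigroups\<close>

text \<open>Operator families are indexed by all reals; only times \<open>t \<ge> 0\<close> are ever constrained or used.\<close>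

definition C0_semigroup :: "(real \<Rightarrow> 'h::real_normed_vector \<Rightarrow>\<^sub>L 'h) \<Rightarrow> bool" where
  "C0_semigroup S \<longleftrightarrow>
     S 0 = id_blinfun \<and>
     (\<forall>s\<ge>0. \<forall>t\<ge>0. S (s + t) = S s o\<^sub>L S t) \<and>
     (\<forall>x. ((\<lambda>t. S t x) \<longlongrightarrow> x) (at_right 0))"

definition linear_operator :: "'h::real_vector set \<Rightarrow> ('h \<Rightarrow> 'h) \<Rightarrow> bool" where
  "linear_operator D A \<longleftrightarrow>
     subspace D \<and>
     (\<forall>x\<in>D. \<forall>y\<in>D. A (x + y) = A x + A y) \<and> (\<forall>c. \<forall>x\<in>D. A (c *\<^sub>R x) = c *\<^sub>R A x)"

definition generates ::
    "'h set \<Rightarrow> ('h \<Rightarrow> 'h) \<Rightarrow> (real \<Rightarrow> 'h::real_normed_vector \<Rightarrow>\<^sub>L 'h) \<Rightarrow> bool" where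
  "generates D G S \<longleftrightarrow>
     C0_semigroup S \<and>
     D = {x. \<exists>y. ((\<lambda>t. (S t x - x) /\<^sub>R t) \<longlongrightarrow> y) (at_right 0)} \<and>
     (\<forall>x\<in>D. ((\<lambda>t. (S t x - x) /\<^sub>R t) \<longlongrightarrow> G x) (at_right 0))"

definition has_bounded_inverse :: "'h::real_normed_vector set \<Rightarrow> ('h \<Rightarrow> 'h) \<Rightarrow> bool" where
  "has_bounded_inverse D A \<longleftrightarrow>
     (\<exists>B :: 'h \<Rightarrow>\<^sub>L 'h. (\<forall>x. B x \<in> D \<and> A (B x) = x) \<and> (\<forall>x\<in>D. B (A x) = x))"

text \<open>The complexification of a real Hilbert space \<open>H\<close> is \<open>H \<times> H\<close> with the product (Hilbert)
  norm, where \<open>(x, y)\<close> stands for \<open>x + \<i> y\<close>. Multiplication by \<open>\<i>\<close> is \<open>cplx_unit\<close>, and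
  the complex-linear operators are the real-linear ones that commute with it.\<close>

definition cplx_unit :: "('h::real_normed_vector \<times> 'h) \<Rightarrow>\<^sub>L ('h \<times> 'h)" where
  "cplx_unit = Blinfun (\<lambda>(x, y). (- y, x))"

definition complexify ::
    "('h::real_normed_vector \<Rightarrow>\<^sub>L 'h) \<Rightarrow> (('h \<times> 'h) \<Rightarrow>\<^sub>L ('h \<times> 'h))" where
  "complexify T = Blinfun (\<lambda>(x, y). (T x, T y))"

lemma cplx_unit_apply [simp]: "cplx_unit (x, y) = (- y, x)"
proof -
  have "bounded_linear (\<lambda>(x :: 'a, y :: 'a). (- y, x))"
    unfolding case_prod_beta
    by (intro bounded_linear_Pair bounded_linear_minus bounded_linear_fst bounded_linear_snd)
  then show ?thesis
    by (simp add: cplx_unit_def bounded_linear_Blinfun_apply)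
qed

lemma complexify_apply [simp]: "complexify T (x, y) = (T x, T y)"
proof -
  have "bounded_linear (\<lambda>(x, y). (T x, T y))"
    unfolding case_prod_beta
    by (intro bounded_linear_Pair blinfun.bounded_linear_right[THEN bounded_linear_compose]
        bounded_linear_fst bounded_linear_snd)
  then show ?thesis
    by (simp add: complexify_def bounded_linear_Blinfun_apply)
qed

definition complex_linear :: "(('h::real_normed_vector \<times> 'h) \<Rightarrow>\<^sub>L ('h \<times> 'h)) \<Rightarrow> bool" where
  "complex_linear T \<longleftrightarrow> T o\<^sub>L cplx_unit = cplx_unit o\<^sub>L T"

definition cplx_scale ::
    "complex \<Rightarrow> (('h::real_normed_vector \<times> 'h) \<Rightarrow>\<^sub>L ('h \<times> 'h)) \<Rightarrow> (('h \<times> 'h) \<Rightarrow>\<^sub>L ('h \<times> 'h))" where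
  "cplx_scale z T = Re z *\<^sub>R T + Im z *\<^sub>R (cplx_unit o\<^sub>L T)"

definition op_holomorphic_on ::
    "(complex \<Rightarrow> ('h::real_normed_vector \<times> 'h) \<Rightarrow>\<^sub>L ('h \<times> 'h)) \<Rightarrow> complex set \<Rightarrow> bool" where
  "op_holomorphic_on F U \<longleftrightarrow>
     (\<forall>z\<in>U. complex_linear (F z)) \<and>
     (\<forall>z\<in>U. \<exists>T. complex_linear T \<and> (F has_derivative (\<lambda>h. cplx_scale h T)) (at z within U))"

definition sector :: "real \<Rightarrow> complex set" where
  "sector \<omega> = {z. z \<noteq> 0 \<and> Arg z \<in> {-\<omega><..<\<omega>}}"

definition bounded_analytic :: "(real \<Rightarrow> 'h::real_normed_vector \<Rightarrow>\<^sub>L 'h) \<Rightarrow> bool" where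
  "bounded_analytic S \<longleftrightarrow>
     (\<exists>\<omega>\<in>{0<..<pi}. \<exists>F. op_holomorphic_on F (sector \<omega>) \<and> bounded (F ` sector \<omega>) \<and>
        (\<forall>t>0. F (complex_of_real t) = complexify (S t)))"

text \<open>The negative fractional power \<open>A\<^sup>-\<^sup>c\<close> in terms of the semigroup generated by \<open>-A\<close>; the
  integral is a Bochner integral in \<open>H\<close> for every vector.\<close>

definition neg_power ::
    "(real \<Rightarrow> 'h::{real_inner,banach,second_countable_topology} \<Rightarrow>\<^sub>L 'h) \<Rightarrow> real \<Rightarrow> ('h \<Rightarrow>\<^sub>L 'h)" where
  "neg_power S c =
     Blinfun (\<lambda>x. (1 / Gamma c) *\<^sub>R (LINT t:{0<..}|lborel. t powr (c - 1) *\<^sub>R S t x))"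


section \<open>Filtrations and cylindrical Wiener processes\<close>

definition normal_filtration :: "'a measure \<Rightarrow> (real \<Rightarrow> 'a measure) \<Rightarrow> bool" where
  "normal_filtration M F \<longleftrightarrow>
     (\<forall>t\<ge>0. subalgebra M (F t)) \<and>
     (\<forall>s\<ge>0. \<forall>t\<ge>s. sets (F s) \<subseteq> sets (F t)) \<and>
     null_sets M \<subseteq> sets (F 0) \<and>
     (\<forall>t\<ge>0. sets (F t) = (\<Inter>s\<in>{t<..}. sets (F s)))"

definition predictable_algebra :: "'a measure \<Rightarrow> (real \<Rightarrow> 'a measure) \<Rightarrow> (real \<times> 'a) measure" where
  "predictable_algebra M F =
     sigma ({0..} \<times> space M)
       ({{0} \<times> E | E. E \<in> sets (F 0)} \<union>
        {{s<..t} \<times> E | s t E. 0 \<le> s \<and> s < t \<and> E \<in> sets (F s)})"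

definition predictable ::
    "'a measure \<Rightarrow> (real \<Rightarrow> 'a measure) \<Rightarrow> (real \<Rightarrow> 'a \<Rightarrow> 'h::topological_space) \<Rightarrow> bool" where
  "predictable M F Z \<longleftrightarrow> (\<lambda>(t, \<omega>). Z t \<omega>) \<in> borel_measurable (predictable_algebra M F)"

text \<open>\<open>W t x\<close> plays the role of \<open>(W\<^sup>Q(t), x)\<^sub>H\<close>: as \<open>Q\<close> need not be trace class, \<open>W\<^sup>Q(t)\<close>
  itself is not an \<open>H\<close>-valued random variable. For every \<open>x\<close> the process \<open>W _ x\<close> is a real
  Brownian motion with respect to the filtration, of variance \<open>t (Q x, x)\<^sub>H\<close>. Linearity in \<open>x\<close>
  yields the covariance \<open>E[W s x * W t y] = min s t * (Q x, y)\<^sub>H\<close>.\<close>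

definition cylindrical_Wiener ::
    "'a measure \<Rightarrow> (real \<Rightarrow> 'a measure) \<Rightarrow> ('h::real_inner \<Rightarrow>\<^sub>L 'h) \<Rightarrow>
     (real \<Rightarrow> 'h \<Rightarrow> 'a \<Rightarrow> real) \<Rightarrow> bool" where
  "cylindrical_Wiener M F Q W \<longleftrightarrow>
     (\<forall>t\<ge>0. \<forall>x. W t x \<in> borel_measurable (F t)) \<and>
     (\<forall>t\<ge>0. \<forall>a b x y. AE \<omega> in M. W t (a *\<^sub>R x + b *\<^sub>R y) \<omega> = a * W t x \<omega> + b * W t y \<omega>) \<and>
     (\<forall>x. AE \<omega> in M. W 0 x \<omega> = 0) \<and>
     (\<forall>x. AE \<omega> in M. continuous_on {0..} (\<lambda>t. W t x \<omega>)) \<and>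
     (\<forall>s t x. 0 \<le> s \<and> s < t \<longrightarrow>
        prob_space.indep_set M (sets (F s))
          (sets (vimage_algebra (space M) (\<lambda>\<omega>. W t x \<omega> - W s x \<omega>) borel)) \<and>
        (if Q x \<bullet> x = 0
         then (AE \<omega> in M. W t x \<omega> - W s x \<omega> = 0)
         else distributed M lborel (\<lambda>\<omega>. W t x \<omega> - W s x \<omega>)
                (\<lambda>u. ennreal (normal_density 0 (sqrt ((t - s) * (Q x \<bullet> x))) u))))"


section \<open>Stochastic integration of deterministic operator-valued functions\<close>

text \<open>A list entry \<open>(a, b, h, f)\<close> stands for the elementary integrand
  \<open>s \<mapsto> indicator {a<..b} s \<cdot> (_, h)\<^sub>H f\<close>, whose integral is \<open>(W\<^sup>Q(b) - W\<^sup>Q(a), h)\<^sub>H f\<close>.\<close>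

type_synonym 'h elementary = "(real \<times> real \<times> 'h \<times> 'h) list"

definition elementary_upto :: "real \<Rightarrow> 'h elementary \<Rightarrow> bool" where
  "elementary_upto t L \<longleftrightarrow> (\<forall>(a, b, h, f)\<in>set L. 0 \<le> a \<and> a \<le> b \<and> b \<le> t)"

definition elementary_fun :: "'h::real_inner elementary \<Rightarrow> real \<Rightarrow> 'h \<Rightarrow>\<^sub>L 'h" where
  "elementary_fun L s =
     (\<Sum>(a, b, h, f)\<leftarrow>L. indicat_real {a<..b} s *\<^sub>R
        (blinfun_scaleR_left f o\<^sub>L blinfun_inner_left h))"

definition elementary_integral ::
    "(real \<Rightarrow> 'h \<Rightarrow> 'a \<Rightarrow> real) \<Rightarrow> 'h::real_inner elementary \<Rightarrow> 'a \<Rightarrow> 'h" where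
  "elementary_integral W L \<omega> = (\<Sum>(a, b, h, f)\<leftarrow>L. (W b h \<omega> - W a h \<omega>) *\<^sub>R f)"

text \<open>\<open>J\<close> is a version of \<open>\<integral>\<^sub>0\<^sup>t \<Phi>(s) dW\<^sup>Q(s)\<close>: the mean-square limit of
  elementary integrals whose integrands converge to \<open>\<Phi>\<close> in the norm of the Ito isometry, i.e. that
  of \<open>\<Phi> Q\<^sup>1\<^sup>/\<^sup>2\<close> in \<open>L\<^sup>2(0, t; L\<^sub>2(H))\<close>. It is determined up to almost sure equality.\<close>

definition has_stoch_integral ::
    "'a measure \<Rightarrow> ('h::{real_inner,banach,second_countable_topology} \<Rightarrow>\<^sub>L 'h) \<Rightarrow>
     (real \<Rightarrow> 'h \<Rightarrow> 'a \<Rightarrow> real) \<Rightarrow> real \<Rightarrow> (real \<Rightarrow> 'h \<Rightarrow>\<^sub>L 'h) \<Rightarrow> ('a \<Rightarrow> 'h) \<Rightarrow> bool" where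
  "has_stoch_integral M Q W t \<Phi> J \<longleftrightarrow>
     J \<in> borel_measurable M \<and>
     (\<exists>L :: nat \<Rightarrow> 'h elementary.
        (\<forall>n. elementary_upto t (L n)) \<and>
        ((\<lambda>n. \<integral>\<^sup>+ s\<in>{0..t}. hs_norm_sq ((\<Phi> s - elementary_fun (L n) s) o\<^sub>L op_sqrt Q) \<partial>lborel)
           \<longlonglongrightarrow> 0) \<and>
        ((\<lambda>n. \<integral>\<^sup>+ \<omega>. ennreal ((norm (J \<omega> - elementary_integral W (L n) \<omega>))\<^sup>2) \<partial>M) \<longlonglongrightarrow> 0))"

definition mild_solution ::
    "'a measure \<Rightarrow> (real \<Rightarrow> 'a measure) \<Rightarrow> ('h::{real_inner,banach,second_countable_topology} \<Rightarrow>\<^sub>L 'h) \<Rightarrow>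
     (real \<Rightarrow> 'h \<Rightarrow> 'a \<Rightarrow> real) \<Rightarrow> (real \<Rightarrow> 'h \<Rightarrow>\<^sub>L 'h) \<Rightarrow> real \<Rightarrow> (real \<Rightarrow> 'a \<Rightarrow> 'h) \<Rightarrow> bool" where
  "mild_solution M F Q W S \<gamma> Z \<longleftrightarrow>
     predictable M F Z \<and>
     (\<forall>t\<ge>0. \<exists>J. has_stoch_integral M Q W t (\<lambda>s. (t - s) powr (\<gamma> - 1) *\<^sub>R S (t - s)) J \<and>
        (AE \<omega> in M. Z t \<omega> = (1 / Gamma \<gamma>) *\<^sub>R J \<omega>))"

definition covariance_op ::
    "'a measure \<Rightarrow> (real \<Rightarrow> 'a \<Rightarrow> 'h::{real_inner,banach,second_countable_topology}) \<Rightarrow>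
     real \<Rightarrow> real \<Rightarrow> ('h \<Rightarrow>\<^sub>L 'h)" where
  "covariance_op M Z s t =
     (THE C :: 'h \<Rightarrow>\<^sub>L 'h. \<forall>x y. C x \<bullet> y =
        prob_space.expectation M (\<lambda>\<omega>.
          ((Z s \<omega> - prob_space.expectation M (Z s)) \<bullet> x) *
          ((Z t \<omega> - prob_space.expectation M (Z t)) \<bullet> y)))"

end

theory Submission
  imports Defs
begin

text \<open>By the Ito isometry, \<open>Z\<^sub>\<gamma>(t)\<close> has mean zero and the covariance operator
  \<open>\<Gamma>(\<gamma>)\<^sup>-\<^sup>2 \<integral>\<^sub>0\<^sup>t r\<^sup>2\<^sup>\<gamma>\<^sup>-\<^sup>2 S(r) Q S(r)\<^sup>* dr\<close>. As \<open>S(r)\<close> is self-adjoint and commutes with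
  \<open>Q\<close>, the integrand is \<open>r\<^sup>2\<^sup>\<gamma>\<^sup>-\<^sup>2 S(2r) Q\<close>. As \<open>t \<rightarrow> \<infinity>\<close> the integral extends to \<open>(0, \<infinity>)\<close>,
  where the substitution \<open>2r \<mapsto> r\<close> turns it into \<open>2\<^sup>1\<^sup>-\<^sup>2\<^sup>\<gamma> \<Gamma>(2\<gamma> - 1) A\<^sup>1\<^sup>-\<^sup>2\<^sup>\<gamma> Q\<close>, and the
  Legendre duplication formula gives the constant (\<open>duplication_constant\<close>).

  Convergence takes place in operator norm because \<open>r\<^sup>2\<^sup>\<gamma>\<^sup>-\<^sup>2 \<parallel>S(2r)\<parallel>\<close> is integrable on
  \<open>(0, \<infinity>)\<close>. This comes from the Hilbert--Schmidt condition: the semigroup law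
  gives \<open>\<parallel>S(2r)\<parallel> \<le> \<parallel>S(r)\<parallel>\<^sup>2\<close>, and if \<open>Q \<ge> \<theta>\<close> then, by self-adjointness,
  \<open>\<theta> \<parallel>S(r)\<parallel>\<^sup>2 \<le> \<parallel>Q\<^sup>1\<^sup>/\<^sup>2 S(r)\<parallel>\<^sup>2 = \<parallel>S(r) Q\<^sup>1\<^sup>/\<^sup>2\<parallel>\<^sup>2\<close>, which is at most the squared
  Hilbert--Schmidt norm (\<open>norm_S_le_hs\<close>, \<open>weight_integrable\<close>). The operator norm is measurable in
  \<open>r\<close> since an analytic semigroup is norm continuous on \<open>(0, \<infinity>)\<close>
  (\<open>bounded_analytic_norm_continuous\<close>).

  The isometry enters in the weak form \<open>stoch_integral_moments\<close>: the first two moments of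
  the scalar products \<open>(J, x)\<close> of the stochastic integral \<open>J\<close>. For elementary integrands it is a
  computation with the covariance \<open>min s t (Q x, y)\<close> of the Wiener process. Both sides pass to
  the mean-square limit by \<open>mean_square_limit_norm\<close>. On the integrand side, convergence in the
  Hilbert--Schmidt norm of \<open>(\<Phi> - \<Phi>\<^sub>n) Q\<^sup>1\<^sup>/\<^sup>2\<close> implies convergence of the adjoints at every vector.

  The definitions of \<open>op_sqrt\<close> by a definite description and of \<open>hs_norm_sq\<close> by a choice of basis
  acquire content through the unique positive square root (\<open>sqrt_ex1\<close>) and the existence of
  an orthonormal basis (\<open>orthonormal_basis_exists\<close>).\<close>


section \<open>The square root of a strictly positive operator\<close>

lemma self_adjoint_scaleR_add_compose:
  assumes "self_adjoint K" "self_adjoint Y"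
  shows "self_adjoint ((1/2) *\<^sub>R (K + (Y o\<^sub>L Y)))"
  using assms by (simp add: self_adjoint_def blinfun.add_left blinfun.scaleR_left inner_add_left inner_add_right)

text \<open>The equation \<open>Y = (K + Y\<^sup>2) / 2\<close> says \<open>(1 - Y)\<^sup>2 = 1 - K\<close>, so \<open>1 - Y\<close> is a square root of
  \<open>1 - K\<close>. On the ball of radius \<open>k\<close> the right-hand side is a contraction with constant \<open>k\<close>.
  Self-adjointness and commuting with everything that commutes with \<open>K\<close> are preserved by the
  iteration and closed, so they hold for the fixed point.\<close>

lemma sqrt_of_small_perturbation:
  fixes K :: "'h::{real_inner,banach} \<Rightarrow>\<^sub>L 'h"
  assumes "self_adjoint K" and "norm K \<le> k" and "k < 1"
  obtains Y where "norm Y \<le> k" "self_adjoint Y" "(1/2) *\<^sub>R (K + (Y o\<^sub>L Y)) = Y"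
    "\<And>C. C o\<^sub>L K = K o\<^sub>L C \<Longrightarrow> C o\<^sub>L Y = Y o\<^sub>L C"
proof -
  have k0: "0 \<le> k" using assms(2) norm_ge_zero order_trans by blast
  define X where "X = {Y :: 'h \<Rightarrow>\<^sub>L 'h. norm Y \<le> k \<and> self_adjoint Y \<and>
      (\<forall>C. C o\<^sub>L K = K o\<^sub>L C \<longrightarrow> C o\<^sub>L Y = Y o\<^sub>L C)}"
  have cont_comp: "continuous_on UNIV (\<lambda>Y. C o\<^sub>L Y)" "continuous_on UNIV (\<lambda>Y. Y o\<^sub>L C)"
    for C :: "'h \<Rightarrow>\<^sub>L 'h"
    by (intro continuous_intros)+
  have "closed {Y :: 'h \<Rightarrow>\<^sub>L 'h. norm Y \<le> k}"
    by (intro closed_Collect_le continuous_intros)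
  moreover have "closed {Y :: 'h \<Rightarrow>\<^sub>L 'h. self_adjoint Y}"
    unfolding self_adjoint_def
    by (intro closed_Collect_all closed_Collect_eq continuous_intros)
  moreover have "closed {Y :: 'h \<Rightarrow>\<^sub>L 'h. \<forall>C. C o\<^sub>L K = K o\<^sub>L C \<longrightarrow> C o\<^sub>L Y = Y o\<^sub>L C}"
    by (intro closed_Collect_all closed_Collect_imp closed_Collect_eq cont_comp) auto
  ultimately have "closed X"
    unfolding X_def by (intro closed_Collect_conj)
  then have "Topological_Spaces.complete X" by (simp add: complete_eq_closed)
  moreover have "0 \<in> X" by (auto simp: X_def self_adjoint_def k0)
  moreover have "(\<lambda>Y. (1/2) *\<^sub>R (K + (Y o\<^sub>L Y))) ` X \<subseteq> X"
  proof (rule image_subsetI)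
    fix Y assume "Y \<in> X"
    then have Y: "norm Y \<le> k" "self_adjoint Y"
      and Ycomm: "\<And>C. C o\<^sub>L K = K o\<^sub>L C \<Longrightarrow> C o\<^sub>L Y = Y o\<^sub>L C"
      unfolding X_def by blast+
    have "norm (Y o\<^sub>L Y) \<le> k * k"
      using norm_blinfun_compose[of Y Y] mult_mono[OF Y(1) Y(1) k0 norm_ge_zero] by linarith
    also have "\<dots> \<le> k" using k0 assms(3) by (simp add: mult_left_le)
    finally have "norm (K + (Y o\<^sub>L Y)) \<le> 2 * k"
      using assms(2) norm_triangle_ineq[of K "(Y o\<^sub>L Y)"] by linarith
    then have "norm ((1/2) *\<^sub>R (K + (Y o\<^sub>L Y))) \<le> k" by simp
    moreover have "C o\<^sub>L ((1/2) *\<^sub>R (K + (Y o\<^sub>L Y))) = ((1/2) *\<^sub>R (K + (Y o\<^sub>L Y))) o\<^sub>L C"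
      if "C o\<^sub>L K = K o\<^sub>L C" for C
    proof -
      have CY: "C (Y x) = Y (C x)" for x
        using Ycomm[OF that] by (metis blinfun_apply_blinfun_compose)
      have CK: "C (K x) = K (C x)" for x
        using that by (metis blinfun_apply_blinfun_compose)
      show ?thesis
        by (rule blinfun_eqI) (simp add: blinfun.scaleR_right blinfun.scaleR_left blinfun.add_right blinfun.add_left CY CK)
    qed
    ultimately show "(1/2) *\<^sub>R (K + (Y o\<^sub>L Y)) \<in> X"
      using self_adjoint_scaleR_add_compose[OF assms(1) Y(2)] unfolding X_def by blast
  qed
  moreover have "dist ((1/2) *\<^sub>R (K + (Y o\<^sub>L Y))) ((1/2) *\<^sub>R (K + (Z o\<^sub>L Z))) \<le> k * dist Y Z"
    if YZ: "Y \<in> X" "Z \<in> X" for Y Z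
  proof -
    have n: "norm Y \<le> k" "norm Z \<le> k" using YZ unfolding X_def by blast+
    have "(Y o\<^sub>L Y) - (Z o\<^sub>L Z) = (Y o\<^sub>L (Y - Z)) + ((Y - Z) o\<^sub>L Z)"
      by (rule blinfun_eqI) (simp add: blinfun.diff_right blinfun.diff_left blinfun.add_left)
    then have "norm ((Y o\<^sub>L Y) - (Z o\<^sub>L Z)) \<le> norm Y * norm (Y - Z) + norm (Y - Z) * norm Z"
      using norm_triangle_mono[OF norm_blinfun_compose[of Y "Y - Z"] norm_blinfun_compose[of "Y - Z" Z]] by simp
    also have "\<dots> \<le> k * norm (Y - Z) + norm (Y - Z) * k"
      using n by (intro add_mono mult_mono) (auto simp: k0)
    finally have "norm ((Y o\<^sub>L Y) - (Z o\<^sub>L Z)) \<le> 2 * k * norm (Y - Z)" by simp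
    moreover have "(1/2) *\<^sub>R (K + (Y o\<^sub>L Y)) - (1/2) *\<^sub>R (K + (Z o\<^sub>L Z)) = (1/2) *\<^sub>R ((Y o\<^sub>L Y) - (Z o\<^sub>L Z))"
      by (simp add: algebra_simps)
    ultimately show ?thesis unfolding dist_norm by simp
  qed
  ultimately have "\<exists>!Y\<in>X. (1/2) *\<^sub>R (K + (Y o\<^sub>L Y)) = Y"
    by (intro Banach_fix[of X k] k0 assms(3)) auto
  then obtain Y where Y: "Y \<in> X" "(1/2) *\<^sub>R (K + (Y o\<^sub>L Y)) = Y" by blast
  show thesis
  proof (rule that[OF _ _ Y(2)])
    show "norm Y \<le> k" "self_adjoint Y" using Y(1) unfolding X_def by blast+
    show "C o\<^sub>L Y = Y o\<^sub>L C" if "C o\<^sub>L K = K o\<^sub>L C" for C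
      using Y(1) that unfolding X_def by blast
  qed
qed

text \<open>For small \<open>\<epsilon>\<close> the operator \<open>K = 1 - \<epsilon> Q\<close> has norm below one, so a multiple of the root of
  \<open>1 - K\<close> is a root \<open>R\<close> of \<open>Q\<close>. Another positive root \<open>T\<close> commutes with \<open>Q\<close>, hence with \<open>R\<close>, and
  \<open>(R + T) (T - R) = 0\<close>. Strict positivity of \<open>R\<close> then forces \<open>T = R\<close>.\<close>

lemma sqrt_ex1:
  fixes Q :: "'h::{real_inner,banach} \<Rightarrow>\<^sub>L 'h"
  assumes sa: "self_adjoint Q" and sp: "strictly_positive Q"
  shows "\<exists>!R. self_adjoint R \<and> (\<forall>x. R x \<bullet> x \<ge> 0) \<and> R o\<^sub>L R = Q"
proof -
  obtain \<theta> where \<theta>: "\<theta> > 0" "\<And>x. Q x \<bullet> x \<ge> \<theta> * (norm x)\<^sup>2"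
    using sp by (auto simp: strictly_positive_def)
  define m where "m = max (norm Q) \<theta>"
  have m: "m > 0" "\<theta> \<le> m" "norm Q \<le> m" using \<theta> by (auto simp: m_def)
  define \<epsilon> where "\<epsilon> = \<theta> / m\<^sup>2"
  have \<epsilon>: "\<epsilon> > 0" using \<theta> m by (simp add: \<epsilon>_def)
  \<comment> \<open>From \<open>\<parallel>x - \<epsilon> Q x\<parallel>\<^sup>2 \<le> (1 - 2\<epsilon>\<theta> + \<epsilon>\<^sup>2 m\<^sup>2) \<parallel>x\<parallel>\<^sup>2\<close>; \<open>\<epsilon> = \<theta> / m\<^sup>2\<close> minimizes the bound.\<close>
  define k where "k = sqrt (1 - \<theta>\<^sup>2 / m\<^sup>2)"
  have rad: "0 \<le> 1 - \<theta>\<^sup>2 / m\<^sup>2" using \<theta>(1) m by (simp add: divide_le_eq_1 power_mono)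
  then have k: "0 \<le> k" "k < 1" "k\<^sup>2 = 1 - \<theta>\<^sup>2 / m\<^sup>2"
    using \<theta>(1) m by (auto simp: k_def)
  define K where "K = id_blinfun - \<epsilon> *\<^sub>R Q"
  have Kx: "K x = x - \<epsilon> *\<^sub>R Q x" for x
    by (simp add: K_def blinfun.diff_left blinfun.scaleR_left)
  have saK: "self_adjoint K"
    using sa by (simp add: self_adjoint_def Kx inner_diff_left inner_diff_right)
  have "norm K \<le> k"
  proof (rule norm_blinfun_bound[OF k(1)])
    fix x
    have "(norm (Q x))\<^sup>2 \<le> (m * norm x)\<^sup>2"
      using order_trans[OF norm_blinfun[of Q x] mult_right_mono[OF m(3) norm_ge_zero]]
      by (intro power_mono) auto
    then have q: "\<epsilon>\<^sup>2 * (norm (Q x))\<^sup>2 \<le> \<epsilon>\<^sup>2 * (m\<^sup>2 * (norm x)\<^sup>2)"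
      by (intro mult_left_mono) (auto simp: power_mult_distrib)
    have p: "2 * \<epsilon> * (\<theta> * (norm x)\<^sup>2) \<le> 2 * \<epsilon> * (Q x \<bullet> x)"
      using \<theta>(2)[of x] \<epsilon> by simp
    have "(norm (K x))\<^sup>2 = (norm x)\<^sup>2 - 2 * \<epsilon> * (Q x \<bullet> x) + \<epsilon>\<^sup>2 * (norm (Q x))\<^sup>2"
      unfolding Kx power2_norm_eq_inner
      by (simp add: inner_diff_left inner_diff_right inner_commute power2_eq_square algebra_simps)
    also have "\<dots> \<le> (norm x)\<^sup>2 - 2 * \<epsilon> * (\<theta> * (norm x)\<^sup>2) + \<epsilon>\<^sup>2 * (m\<^sup>2 * (norm x)\<^sup>2)"
      using p q by linarith
    also have "\<dots> = k\<^sup>2 * (norm x)\<^sup>2"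
      unfolding k(3) \<epsilon>_def using m by (simp add: field_simps power2_eq_square)
    finally have "(norm (K x))\<^sup>2 \<le> (k * norm x)\<^sup>2" by (simp add: power_mult_distrib)
    then show "norm (K x) \<le> k * norm x"
      by (rule power2_le_imp_le) (use k(1) in simp)
  qed
  then obtain Y where Y: "norm Y \<le> k" "self_adjoint Y" "(1/2) *\<^sub>R (K + (Y o\<^sub>L Y)) = Y"
    and Ycomm: "\<And>C. C o\<^sub>L K = K o\<^sub>L C \<Longrightarrow> C o\<^sub>L Y = Y o\<^sub>L C"
    using sqrt_of_small_perturbation[OF saK _ k(2)] by metis
  define R where "R = sqrt (1 / \<epsilon>) *\<^sub>R (id_blinfun - Y)"
  have Rx: "R x = sqrt (1 / \<epsilon>) *\<^sub>R (x - Y x)" for x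
    by (simp add: R_def blinfun.diff_left blinfun.scaleR_left)
  have saR: "self_adjoint R"
    using Y(2) by (simp add: self_adjoint_def Rx inner_diff_left inner_diff_right)
  have Rpos: "R x \<bullet> x \<ge> sqrt (1 / \<epsilon>) * (1 - k) * (norm x)\<^sup>2" for x
  proof -
    have "Y x \<bullet> x \<le> norm (Y x) * norm x" by (rule norm_cauchy_schwarz)
    also have "\<dots> \<le> (k * norm x) * norm x"
      using order_trans[OF norm_blinfun[of Y x] mult_right_mono[OF Y(1) norm_ge_zero]]
      by (intro mult_right_mono) auto
    finally have "(1 - k) * (norm x)\<^sup>2 \<le> (x - Y x) \<bullet> x"
      by (simp add: inner_diff_left power2_norm_eq_inner[symmetric] power2_eq_square algebra_simps)
    then show ?thesis
      using \<epsilon> unfolding Rx by (simp add: mult.assoc mult_left_mono del: real_sqrt_divide)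
  qed
  have RR: "R o\<^sub>L R = Q"
  proof (rule blinfun_eqI)
    fix x
    have "Y x = (1/2) *\<^sub>R (K x + Y (Y x))"
      by (subst Y(3)[symmetric]) (simp add: blinfun.scaleR_left blinfun.add_left)
    then have "Y x + Y x = K x + Y (Y x)"
      by (metis scaleR_half_double scaleR_right_distrib)
    then have "x - Y x - Y x + Y (Y x) = \<epsilon> *\<^sub>R Q x"
      by (simp add: Kx algebra_simps)
    then have "(sqrt (1 / \<epsilon>) * sqrt (1 / \<epsilon>)) *\<^sub>R (x - Y x - Y x + Y (Y x)) = Q x"
      using \<epsilon> by simp
    then show "(R o\<^sub>L R) x = Q x"
      by (simp add: Rx blinfun.scaleR_right blinfun.diff_right algebra_simps)
  qed
  show ?thesis
  proof (rule ex1I[of _ R])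
    have "R x \<bullet> x \<ge> 0" for x
      using order_trans[OF _ Rpos[of x]] k \<epsilon> by simp
    then show "self_adjoint R \<and> (\<forall>x. R x \<bullet> x \<ge> 0) \<and> R o\<^sub>L R = Q" using saR RR by blast
  next
    fix T assume T: "self_adjoint T \<and> (\<forall>x. T x \<bullet> x \<ge> 0) \<and> T o\<^sub>L T = Q"
    then have TT: "T (T x) = Q x" for x by (metis blinfun_apply_blinfun_compose)
    have "T o\<^sub>L K = K o\<^sub>L T"
      by (rule blinfun_eqI) (simp add: Kx blinfun.diff_right blinfun.scaleR_right flip: TT)
    then have TY: "T (Y x) = Y (T x)" for x
      using Ycomm[of T] by (metis blinfun_apply_blinfun_compose)
    have TR: "T (R x) = R (T x)" for x
      by (simp add: Rx blinfun.diff_right blinfun.scaleR_right TY)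
    show "T = R"
    proof (rule blinfun_eqI)
      fix x
      define y where "y = T x - R x"
      have "R (R x) = Q x" by (metis RR blinfun_apply_blinfun_compose)
      then have "R y + T y = 0"
        by (simp add: y_def blinfun.diff_right TR TT)
      then have "R y \<bullet> y + T y \<bullet> y = 0" by (metis inner_add_left inner_zero_left)
      moreover have "T y \<bullet> y \<ge> 0" using T by blast
      ultimately have "R y \<bullet> y \<le> 0" by linarith
      then have "sqrt (1 / \<epsilon>) * (1 - k) * (norm y)\<^sup>2 \<le> 0" using Rpos[of y] by linarith
      moreover have "sqrt (1 / \<epsilon>) * (1 - k) > 0" using k \<epsilon> by simp
      ultimately have "(norm y)\<^sup>2 \<le> 0" by (meson not_le mult_pos_pos)
      then have "y = 0" by simp
      then show "T x = R x" by (simp add: y_def)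
    qed
  qed
qed

lemma op_sqrt:
  fixes Q :: "'h::{real_inner,banach} \<Rightarrow>\<^sub>L 'h"
  assumes "self_adjoint Q" and "strictly_positive Q"
  shows "self_adjoint (op_sqrt Q)" and "op_sqrt Q o\<^sub>L op_sqrt Q = Q"
  using theI'[OF sqrt_ex1[OF assms], folded op_sqrt_def] by blast+

lemma norm_op_sqrt:
  fixes Q :: "'h::{real_inner,banach} \<Rightarrow>\<^sub>L 'h"
  assumes sa: "self_adjoint Q" and sp: "strictly_positive Q"
  shows "(norm (op_sqrt Q v))\<^sup>2 = Q v \<bullet> v"
proof -
  have "op_sqrt Q (op_sqrt Q v) = Q v"
    using op_sqrt(2)[OF sa sp] by (metis blinfun_apply_blinfun_compose)
  moreover have "op_sqrt Q (op_sqrt Q v) \<bullet> v = op_sqrt Q v \<bullet> op_sqrt Q v"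
    using op_sqrt(1)[OF sa sp] by (simp add: self_adjoint_def)
  ultimately show ?thesis by (simp add: power2_norm_eq_inner)
qed


section \<open>Operator norm and Hilbert--Schmidt norm\<close>

text \<open>Gram--Schmidt along a dense sequence: the orthonormal sets \<open>B\<^sub>n\<close> grow with \<open>n\<close>, and the span of
  \<open>B\<^sub>n\<close> contains the first \<open>n\<close> points of the sequence.\<close>

lemma orthonormal_basis_exists:
  "\<exists>B. orthonormal_basis (B :: 'h::{real_inner,second_countable_topology} set)"
proof -
  obtain D :: "'h set" where D: "countable D" "\<And>U. open U \<Longrightarrow> U \<noteq> {} \<Longrightarrow> \<exists>d\<in>D. d \<in> U"
    using countable_dense_setE by blast
  define d where "d = from_nat_into D"
  have "D \<noteq> {}" using D(2)[of UNIV] by auto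
  then have rd: "range d = D" using D(1) by (simp add: d_def range_from_nat_into)
  define P where "P = (\<lambda>n (B :: 'h set). finite B \<and> (\<forall>e\<in>B. norm e = 1) \<and> pairwise orthogonal B \<and>
      (\<forall>i<n. d i \<in> span B))"
  have step: "\<exists>C. P (Suc n) C \<and> B \<subseteq> C" if B: "P n B" for n B
  proof -
    define r where "r = d n - (\<Sum>e\<in>B. (d n \<bullet> e) *\<^sub>R e)"
    have s: "(\<Sum>e\<in>B. (d n \<bullet> e) *\<^sub>R e) \<in> span B"
      by (intro span_sum span_scale span_base)
    show ?thesis
    proof (cases "r = 0")
      case True
      then have "d n \<in> span B" using s by (simp add: r_def)
      then show ?thesis using B by (intro exI[of _ B]) (auto simp: P_def less_Suc_eq)
    next
      case False
      have orth: "r \<bullet> f = 0" if f: "f \<in> B" for f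
      proof -
        have "(\<Sum>e\<in>B. (d n \<bullet> e) * (e \<bullet> f)) = (\<Sum>e\<in>B. if e = f then d n \<bullet> f else 0)"
          using B f by (intro sum.cong) (auto simp: P_def pairwise_def orthogonal_def norm_eq_1)
        then show ?thesis
          using B f by (simp add: r_def inner_diff_left inner_sum_left P_def)
      qed
      let ?C = "insert (r /\<^sub>R norm r) B"
      have sub: "span B \<subseteq> span ?C" by (rule span_mono) auto
      have "r /\<^sub>R norm r \<in> span ?C" by (simp add: span_base)
      then have "norm r *\<^sub>R (r /\<^sub>R norm r) \<in> span ?C" by (rule span_scale)
      then have "r \<in> span ?C" using False by simp
      then have "r + (\<Sum>e\<in>B. (d n \<bullet> e) *\<^sub>R e) \<in> span ?C"
        using s sub by (intro span_add) auto
      then have "d n \<in> span ?C" by (simp add: r_def)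
      moreover have "pairwise orthogonal ?C"
        using B orth by (auto simp: P_def pairwise_insert orthogonal_def inner_commute)
      ultimately have "P (Suc n) ?C"
        using B sub False by (auto simp: P_def less_Suc_eq)
      then show ?thesis by blast
    qed
  qed
  have "P 0 {}" by (simp add: P_def)
  then obtain B where B: "\<And>n. P n (B n)" "\<And>n. B n \<subseteq> B (Suc n)"
    using dependent_nat_choice[of P "\<lambda>_ B C. B \<subseteq> C"] step by metis
  have "incseq B" using B(2) by (simp add: incseq_SucI)
  have "orthonormal_basis (\<Union>n. B n)"
    unfolding orthonormal_basis_def
  proof (intro conjI ballI impI)
    show "norm e = 1" if "e \<in> (\<Union>n. B n)" for e using that B(1) by (auto simp: P_def)
    show "e \<bullet> f = 0" if ef: "e \<in> (\<Union>n. B n)" "f \<in> (\<Union>n. B n)" "e \<noteq> f" for e f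
    proof -
      obtain i j where "e \<in> B i" "f \<in> B j" using ef by blast
      then have "e \<in> B (max i j)" "f \<in> B (max i j)"
        using \<open>incseq B\<close> by (meson incseqD max.cobounded1 max.cobounded2 subsetD)+
      then show ?thesis using B(1)[of "max i j"] ef(3) by (auto simp: P_def pairwise_def orthogonal_def)
    qed
    have "D \<subseteq> span (\<Union>n. B n)"
    proof
      fix y assume "y \<in> D"
      then obtain n where "y = d n" using rd by blast
      then have "y \<in> span (B (Suc n))" using B(1)[of "Suc n"] by (auto simp: P_def)
      then show "y \<in> span (\<Union>n. B n)" using span_mono[of "B (Suc n)" "\<Union>n. B n"] by auto
    qed
    moreover have "closure D = UNIV"
      using D(2) by (auto simp: closure_iff_nhds_not_empty) (metis IntI empty_iff subsetD)
    ultimately show "closure (span (\<Union>n. B n)) = UNIV"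
      using closure_mono by blast
  qed
  then show ?thesis by blast
qed

text \<open>On finite combinations of basis vectors this is the Cauchy--Schwarz inequality; these are
  dense.\<close>

lemma norm_sq_le_hs_norm_sq:
  fixes T :: "'h::{real_inner,banach,second_countable_topology} \<Rightarrow>\<^sub>L 'h"
  shows "ennreal ((norm T)\<^sup>2) \<le> hs_norm_sq T"
proof (cases "hs_norm_sq T")
  case (real c)
  define B where "B = (SOME B :: 'h set. orthonormal_basis B)"
  have B: "orthonormal_basis B"
    unfolding B_def by (rule someI_ex[OF orthonormal_basis_exists])
  have hs: "hs_norm_sq T = (\<integral>\<^sup>+ e. ennreal ((norm (T e))\<^sup>2) \<partial>count_space B)"
    by (simp add: hs_norm_sq_def B_def)
  have fin: "(\<Sum>e\<in>E. (norm (T e))\<^sup>2) \<le> c" if E: "finite E" "E \<subseteq> B" for E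
  proof -
    have "ennreal (\<Sum>e\<in>E. (norm (T e))\<^sup>2) = (\<integral>\<^sup>+ e. ennreal ((norm (T e))\<^sup>2) \<partial>count_space E)"
      using E by (simp add: nn_integral_count_space_finite)
    also have "\<dots> = (\<integral>\<^sup>+ e. ennreal ((norm (T e))\<^sup>2) * indicator E e \<partial>count_space B)"
      using E(2) by (auto simp: nn_integral_count_space_indicator intro!: nn_integral_cong split: split_indicator)
    also have "\<dots> \<le> ennreal c"
      unfolding real(2)[symmetric] hs by (intro nn_integral_mono) (auto split: split_indicator)
    finally show ?thesis using real(1) by (simp add: ennreal_le_iff)
  qed
  have "span B \<subseteq> {x. norm (T x) \<le> sqrt c * norm x}"
  proof
    fix x assume "x \<in> span B"
    then obtain E u where E: "finite E" "E \<subseteq> B" "x = (\<Sum>e\<in>E. u e *\<^sub>R e)"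
      unfolding span_explicit by blast
    have ip: "e \<bullet> f = (if f = e then 1 else 0)" if "e \<in> E" "f \<in> E" for e f
      using B E(2) that unfolding orthonormal_basis_def norm_eq_1 by (metis subsetD)
    have nx: "(norm x)\<^sup>2 = (\<Sum>e\<in>E. (u e)\<^sup>2)"
    proof -
      have "x \<bullet> x = (\<Sum>e\<in>E. u e * (\<Sum>f\<in>E. u f * (e \<bullet> f)))"
        by (simp add: E(3) inner_sum_left inner_sum_right inner_commute sum_distrib_left ac_simps)
      also have "\<dots> = (\<Sum>e\<in>E. u e * (\<Sum>f\<in>E. if f = e then u e else 0))"
        by (intro sum.cong arg_cong2[of _ _ _ _ "(*)"] refl) (simp add: ip)
      finally show ?thesis using E(1) by (simp add: dot_square_norm power2_eq_square)
    qed
    have "norm (T x) \<le> (\<Sum>e\<in>E. \<bar>u e\<bar> * norm (T e))"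
      unfolding E(3) blinfun.sum_right blinfun.scaleR_right by (rule sum_norm_le) simp
    also have "\<dots> \<le> sqrt ((\<Sum>e\<in>E. \<bar>u e\<bar>\<^sup>2) * (\<Sum>e\<in>E. (norm (T e))\<^sup>2))"
      by (rule real_le_rsqrt) (rule Cauchy_Schwarz_ineq_sum)
    also have "\<dots> \<le> sqrt ((norm x)\<^sup>2 * c)"
      using fin[OF E(1,2)] nx by (auto intro!: mult_left_mono sum_nonneg)
    also have "\<dots> = sqrt c * norm x" by (simp add: real_sqrt_mult)
    finally show "x \<in> {x. norm (T x) \<le> sqrt c * norm x}" by simp
  qed
  moreover have "closed {x. norm (T x) \<le> sqrt c * norm x}"
    by (intro closed_Collect_le continuous_intros)
  ultimately have "closure (span B) \<subseteq> {x. norm (T x) \<le> sqrt c * norm x}"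
    by (rule closure_minimal)
  then have "norm (T x) \<le> sqrt c * norm x" for x
    using B by (auto simp: orthonormal_basis_def)
  then have "norm T \<le> sqrt c" using real(1) by (intro norm_blinfun_bound) auto
  then have "(norm T)\<^sup>2 \<le> c"
    using real(1) by (metis norm_ge_zero power_mono real_sqrt_pow2)
  then show ?thesis using real by simp
qed simp

text \<open>One half of \<open>\<parallel>T\<^sup>*\<parallel> = \<parallel>T\<parallel>\<close>, with the adjoint \<open>U\<close> given explicitly:
  \<open>\<parallel>U y\<parallel>\<^sup>2 = (T U y, y)\<close>.\<close>

lemma norm_le_norm_of_adjoint_pair:
  fixes T U :: "'h::real_inner \<Rightarrow>\<^sub>L 'h"
  assumes "\<And>x y. T x \<bullet> y = x \<bullet> U y"
  shows "norm U \<le> norm T"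
proof (rule norm_blinfun_bound)
  fix y
  have "(norm (U y))\<^sup>2 = T (U y) \<bullet> y"
    using assms[of "U y" y] by (simp add: power2_norm_eq_inner)
  also have "\<dots> \<le> norm (T (U y)) * norm y" by (rule norm_cauchy_schwarz)
  also have "\<dots> \<le> norm T * norm (U y) * norm y"
    by (intro mult_right_mono norm_blinfun) auto
  finally have "norm (U y) * norm (U y) \<le> norm (U y) * (norm T * norm y)"
    by (simp add: power2_eq_square ac_simps)
  then show "norm (U y) \<le> norm T * norm y"
    by (cases "U y = 0") (auto simp: mult_le_cancel_left_pos)
qed simp

section \<open>Limits in mean square\<close>

text \<open>Convergence in \<open>L\<^sup>2\<close> implies convergence of the squared norms. The difference is controlled by
  \<open>|\<parallel>g\<parallel>\<^sup>2 - \<parallel>f\<parallel>\<^sup>2| \<le> e \<parallel>f\<parallel>\<^sup>2 + (1/e + 1) \<parallel>f - g\<parallel>\<^sup>2\<close>, a form of Young's inequality, with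
  \<open>e\<close> tending to zero more slowly than the squared distance.\<close>

lemma mean_square_limit_norm:
  fixes f :: "'a \<Rightarrow> 'b::{banach,second_countable_topology}" and g :: "nat \<Rightarrow> 'a \<Rightarrow> 'b"
  assumes f[measurable]: "f \<in> borel_measurable N" and g[measurable]: "\<And>n. g n \<in> borel_measurable N"
    and g2: "\<And>n. integrable N (\<lambda>x. (norm (g n x))\<^sup>2)"
    and lim: "(\<lambda>n. \<integral>\<^sup>+ x. ennreal ((norm (f x - g n x))\<^sup>2) \<partial>N) \<longlonglongrightarrow> 0"
  shows "integrable N (\<lambda>x. (norm (f x))\<^sup>2)"
    and "(\<lambda>n. \<integral>x. (norm (g n x))\<^sup>2 \<partial>N) \<longlonglongrightarrow> (\<integral>x. (norm (f x))\<^sup>2 \<partial>N)"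
proof -
  have sq: "(norm (u + v))\<^sup>2 \<le> 2 * (norm u)\<^sup>2 + 2 * (norm v)\<^sup>2" for u v :: 'b
  proof -
    have "(norm (u + v))\<^sup>2 \<le> (norm u + norm v)\<^sup>2"
      by (intro power_mono norm_triangle_ineq) simp
    also have "\<dots> \<le> 2 * (norm u)\<^sup>2 + 2 * (norm v)\<^sup>2"
      using sum_squares_bound[of "norm u" "norm v"] by (simp add: power2_sum)
    finally show ?thesis .
  qed
  have "eventually (\<lambda>n. (\<integral>\<^sup>+ x. ennreal ((norm (f x - g n x))\<^sup>2) \<partial>N) < 1) sequentially"
    using order_tendstoD(2)[OF lim, of 1] by simp
  then obtain n where n: "(\<integral>\<^sup>+ x. ennreal ((norm (f x - g n x))\<^sup>2) \<partial>N) < 1"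
    by (auto simp: eventually_sequentially)
  have "integrable N (\<lambda>x. (norm (f x - g n x))\<^sup>2)"
    using n by (intro integrableI_bounded) (auto intro: less_trans)
  then have "integrable N (\<lambda>x. 2 * (norm (f x - g n x))\<^sup>2 + 2 * (norm (g n x))\<^sup>2)"
    using g2 by simp
  then show f2: "integrable N (\<lambda>x. (norm (f x))\<^sup>2)"
    by (rule Bochner_Integration.integrable_bound)
      (use sq[of "f x - g n x" "g n x" for x] in \<open>auto intro!: AE_I2\<close>)
  have d2: "integrable N (\<lambda>x. (norm (f x - g n x))\<^sup>2)" for n
  proof (rule Bochner_Integration.integrable_bound)
    show "integrable N (\<lambda>x. 2 * (norm (f x))\<^sup>2 + 2 * (norm (g n x))\<^sup>2)"
      using f2 g2 by simp
    show "AE x in N. norm ((norm (f x - g n x))\<^sup>2) \<le> norm (2 * (norm (f x))\<^sup>2 + 2 * (norm (g n x))\<^sup>2)"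
      using sq[of "f x" "- g n x" for x] by (auto intro!: AE_I2)
  qed simp
  define D where "D n = (\<integral>x. (norm (f x - g n x))\<^sup>2 \<partial>N)" for n
  have D0: "D n \<ge> 0" for n by (simp add: D_def)
  have "(\<integral>\<^sup>+ x. ennreal ((norm (f x - g n x))\<^sup>2) \<partial>N) = ennreal (D n)" for n
    unfolding D_def using d2 by (intro nn_integral_eq_integral) auto
  then have D: "D \<longlonglongrightarrow> 0"
    using lim D0 by (simp add: tendsto_ennreal_iff[of D sequentially 0] flip: ennreal_0)
  \<comment> \<open>The second summand keeps \<open>\<eta> n\<close> positive when the distance vanishes.\<close>
  define \<eta> where "\<eta> n = sqrt (D n) + inverse (Suc n)" for n
  have \<eta>: "\<eta> n > 0" "sqrt (D n) \<le> \<eta> n" for n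
    using D0[of n] by (auto simp: \<eta>_def add_nonneg_pos)
  have \<eta>0: "\<eta> \<longlonglongrightarrow> 0"
    using tendsto_add[OF tendsto_real_sqrt[OF D] LIMSEQ_inverse_real_of_nat] by (simp add: \<eta>_def[abs_def])
  define C where "C = (\<integral>x. (norm (f x))\<^sup>2 \<partial>N)"
  have pw: "\<bar>(norm v)\<^sup>2 - (norm u)\<^sup>2\<bar> \<le> e * (norm u)\<^sup>2 + (1 / e + 1) * (norm (u - v))\<^sup>2"
    if "e > 0" for e :: real and u v :: 'b
  proof -
    define p q r where "p = norm u" and "q = norm v" and "r = norm (u - v)"
    have pq: "\<bar>q - p\<bar> \<le> r" "p \<ge> 0" "q \<ge> 0" "r \<ge> 0"
      using norm_triangle_ineq3[of v u] by (auto simp: p_def q_def r_def norm_minus_commute)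
    have "\<bar>q\<^sup>2 - p\<^sup>2\<bar> = \<bar>q - p\<bar> * (q + p)"
    proof -
      have "q\<^sup>2 - p\<^sup>2 = (q - p) * (q + p)" by (simp add: power2_eq_square algebra_simps)
      then show ?thesis using pq by (simp add: abs_mult)
    qed
    also have "\<dots> \<le> r * (2 * p + r)"
      using pq by (intro mult_mono) auto
    also have "\<dots> = 2 * p * r + r\<^sup>2" by (simp add: power2_eq_square algebra_simps)
    also have "2 * p * r \<le> e * p\<^sup>2 + r\<^sup>2 / e"
    proof -
      have "0 \<le> (e * p - r)\<^sup>2 / e" using that by simp
      also have "\<dots> = e * p\<^sup>2 + r\<^sup>2 / e - 2 * p * r"
        using that by (simp add: field_simps power2_eq_square)
      finally show ?thesis by simp
    qed
    finally show ?thesis by (simp add: p_def q_def r_def algebra_simps)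
  qed
  have "norm ((\<integral>x. (norm (g n x))\<^sup>2 \<partial>N) - C) \<le> \<eta> n * C + (sqrt (D n) + D n)" for n
  proof -
    have "norm ((\<integral>x. (norm (g n x))\<^sup>2 \<partial>N) - C) = norm (\<integral>x. (norm (g n x))\<^sup>2 - (norm (f x))\<^sup>2 \<partial>N)"
      using f2 g2 by (simp add: C_def)
    also have "\<dots> \<le> (\<integral>x. \<bar>(norm (g n x))\<^sup>2 - (norm (f x))\<^sup>2\<bar> \<partial>N)"
      unfolding real_norm_def by (rule integral_abs_bound)
    also have "\<dots> \<le> (\<integral>x. \<eta> n * (norm (f x))\<^sup>2 + (1 / \<eta> n + 1) * (norm (f x - g n x))\<^sup>2 \<partial>N)"
      using f2 g2 d2 pw[OF \<eta>(1)] by (intro integral_mono) auto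
    also have "\<dots> = \<eta> n * C + (1 / \<eta> n + 1) * D n"
      using f2 d2 by (simp add: C_def D_def)
    also have "D n / \<eta> n \<le> sqrt (D n)"
    proof -
      have "D n = sqrt (D n) * sqrt (D n)" using D0 by simp
      also have "\<dots> \<le> sqrt (D n) * \<eta> n" using \<eta>(2) D0 by (intro mult_left_mono) auto
      finally show ?thesis using \<eta>(1) by (simp add: divide_le_eq)
    qed
    then have "\<eta> n * C + (1 / \<eta> n + 1) * D n \<le> \<eta> n * C + (sqrt (D n) + D n)"
      by (simp add: algebra_simps)
    finally show ?thesis .
  qed
  moreover have "(\<lambda>n. \<eta> n * C + (sqrt (D n) + D n)) \<longlonglongrightarrow> 0"
    using tendsto_add[OF tendsto_mult_left_zero[OF \<eta>0] tendsto_add[OF tendsto_real_sqrt[OF D] D]] by simp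
  ultimately have "(\<lambda>n. (\<integral>x. (norm (g n x))\<^sup>2 \<partial>N) - C) \<longlonglongrightarrow> 0"
    by (rule Lim_null_comparison[OF always_eventually[OF allI]])
  then show "(\<lambda>n. \<integral>x. (norm (g n x))\<^sup>2 \<partial>N) \<longlonglongrightarrow> (\<integral>x. (norm (f x))\<^sup>2 \<partial>N)"
    by (simp add: C_def LIM_zero_iff)
qed

text \<open>Measurability is assumed of the smaller function alone, so that \<open>h\<close> may be built from
  \<open>hs_norm_sq\<close>, for which measurability in time would require a separate argument.\<close>

lemma nn_integral_le_cmult:
  fixes c :: real and g h :: "'a \<Rightarrow> ennreal"
  assumes c: "c > 0" and g[measurable]: "g \<in> borel_measurable N"
    and le: "\<And>x. x \<in> space N \<Longrightarrow> g x \<le> ennreal c * h x"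
  shows "(\<integral>\<^sup>+ x. g x \<partial>N) \<le> ennreal c * (\<integral>\<^sup>+ x. h x \<partial>N)"
proof -
  have inv: "ennreal (1 / c) * ennreal c = 1" "ennreal c * ennreal (1 / c) = 1"
    using c by (simp_all flip: ennreal_mult)
  have "ennreal (1 / c) * g x \<le> h x" if "x \<in> space N" for x
    using mult_left_mono[OF le[OF that], of "ennreal (1 / c)"] inv by (simp flip: mult.assoc)
  then have "(\<integral>\<^sup>+ x. ennreal (1 / c) * g x \<partial>N) \<le> (\<integral>\<^sup>+ x. h x \<partial>N)"
    by (rule nn_integral_mono)
  then have "ennreal (1 / c) * (\<integral>\<^sup>+ x. g x \<partial>N) \<le> (\<integral>\<^sup>+ x. h x \<partial>N)"
    by (simp add: nn_integral_cmult)
  from mult_left_mono[OF this, of "ennreal c"] show ?thesis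
    using inv by (simp flip: mult.assoc)
qed

lemma square_integrable_mult:
  fixes f g :: "'a \<Rightarrow> real"
  assumes [measurable]: "f \<in> borel_measurable N" "g \<in> borel_measurable N"
    and "integrable N (\<lambda>x. (f x)\<^sup>2)" "integrable N (\<lambda>x. (g x)\<^sup>2)"
  shows "integrable N (\<lambda>x. f x * g x)"
proof (rule Bochner_Integration.integrable_bound)
  show "integrable N (\<lambda>x. (f x)\<^sup>2 + (g x)\<^sup>2)" using assms by simp
  have "\<bar>f x * g x\<bar> \<le> (f x)\<^sup>2 + (g x)\<^sup>2" for x
  proof -
    have "2 * (\<bar>f x\<bar> * \<bar>g x\<bar>) \<le> (f x)\<^sup>2 + (g x)\<^sup>2"
      using sum_squares_bound[of "\<bar>f x\<bar>" "\<bar>g x\<bar>"] by simp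
    moreover have "0 \<le> \<bar>f x\<bar> * \<bar>g x\<bar>" by simp
    ultimately show ?thesis unfolding abs_mult by linarith
  qed
  then show "AE x in N. norm (f x * g x) \<le> norm ((f x)\<^sup>2 + (g x)\<^sup>2)" by (auto intro!: AE_I2)
qed simp


section \<open>Covariance of the cylindrical Wiener process\<close>

text \<open>The covariance of two increments of a standard Brownian motion is the length of the overlap of
  the time intervals.\<close>

lemma min_increments_eq_overlap:
  fixes a b a' b' :: real
  assumes "a \<le> b" "a' \<le> b'"
  shows "has_bochner_integral lborel (\<lambda>s. indicat_real {a<..b} s * indicat_real {a'<..b'} s)
     (min b b' - min b a' - min a b' + min a a')"
proof -
  have "(\<lambda>s. indicat_real {a<..b} s * indicat_real {a'<..b'} s) =
      indicat_real {max a a'<..min b b'}"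
    by (auto simp: indicator_def fun_eq_iff)
  moreover have "min b b' - min b a' - min a b' + min a a' = measure lborel {max a a'<..min b b'}"
    using assms by (auto simp: min_def max_def)
  moreover have "has_bochner_integral lborel (indicat_real {max a a'<..min b b'})
      (measure lborel {max a a'<..min b b'})"
    by (intro has_bochner_integral_real_indicator, simp, cases "max a a' \<le> min b b'") (auto simp: emeasure_lborel_Ioc[of "max a a'" "min b b'"] not_le)
  ultimately show ?thesis by simp
qed

locale wiener = prob_space M for M :: "'a measure" +
  fixes F :: "real \<Rightarrow> 'a measure"
    and Q :: "'h::{real_inner,banach,second_countable_topology} \<Rightarrow>\<^sub>L 'h"
    and W :: "real \<Rightarrow> 'h \<Rightarrow> 'a \<Rightarrow> real"
  assumes filtration: "normal_filtration M F"
    and sa: "self_adjoint Q"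
    and sp: "strictly_positive Q"
    and wiener: "cylindrical_Wiener M F Q W"
begin

lemma W_adapted: "t \<ge> 0 \<Longrightarrow> W t x \<in> borel_measurable (F t)"
  using wiener by (simp add: cylindrical_Wiener_def)

lemma W_measurable [measurable]:
  assumes "t \<ge> 0" shows "W t x \<in> borel_measurable M"
  using measurable_from_subalg[OF _ W_adapted[OF assms]] filtration assms
  by (simp add: normal_filtration_def)

lemma W_0: "AE \<omega> in M. W 0 x \<omega> = 0"
  using wiener by (simp add: cylindrical_Wiener_def)

lemma W_add: "t \<ge> 0 \<Longrightarrow> AE \<omega> in M. W t (x + y) \<omega> = W t x \<omega> + W t y \<omega>"
proof -
  assume "t \<ge> 0"
  then have "AE \<omega> in M. W t (1 *\<^sub>R x + 1 *\<^sub>R y) \<omega> = 1 * W t x \<omega> + 1 * W t y \<omega>"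
    using wiener unfolding cylindrical_Wiener_def by blast
  then show ?thesis by simp
qed

lemma increment_moments:
  assumes st: "0 \<le> s" "s < t"
  shows "integrable M (\<lambda>\<omega>. (W t x \<omega> - W s x \<omega>)\<^sup>2)"
    and "expectation (\<lambda>\<omega>. W t x \<omega> - W s x \<omega>) = 0"
    and "expectation (\<lambda>\<omega>. (W t x \<omega> - W s x \<omega>)\<^sup>2) = (t - s) * (Q x \<bullet> x)"
proof -
  have t: "0 \<le> t" using st by simp
  note [measurable] = W_measurable[OF st(1)] W_measurable[OF t]
  let ?X = "\<lambda>\<omega>. W t x \<omega> - W s x \<omega>"
  have law: "if Q x \<bullet> x = 0 then (AE \<omega> in M. ?X \<omega> = 0)
      else distributed M lborel ?X (\<lambda>u. ennreal (normal_density 0 (sqrt ((t - s) * (Q x \<bullet> x))) u))"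
    using wiener st unfolding cylindrical_Wiener_def by blast
  have "integrable M (\<lambda>\<omega>. (?X \<omega>)\<^sup>2) \<and> expectation ?X = 0 \<and>
    expectation (\<lambda>\<omega>. (?X \<omega>)\<^sup>2) = (t - s) * (Q x \<bullet> x)"
  proof (cases "Q x \<bullet> x = 0")
    case True
    then have X0: "AE \<omega> in M. ?X \<omega> = 0"
      using law by (simp only: if_True simp_thms)
    have "integrable M (\<lambda>\<omega>. (?X \<omega>)\<^sup>2) \<longleftrightarrow> integrable M (\<lambda>\<omega>. 0 :: real)"
      using X0 by (intro integrable_cong_AE) auto
    moreover have "expectation ?X = expectation (\<lambda>\<omega>. 0)"
      using X0 by (intro integral_cong_AE) auto
    moreover have "expectation (\<lambda>\<omega>. (?X \<omega>)\<^sup>2) = expectation (\<lambda>\<omega>. 0)"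
      using X0 by (intro integral_cong_AE) auto
    ultimately show ?thesis using True by simp
  next
    case False
    obtain \<theta> where "\<theta> > 0" "Q x \<bullet> x \<ge> \<theta> * (norm x)\<^sup>2"
      using sp unfolding strictly_positive_def by blast
    then have "Q x \<bullet> x \<ge> 0" by (meson mult_nonneg_nonneg order_trans less_imp_le zero_le_power2)
    with False have Qx: "Q x \<bullet> x > 0" by simp
    define \<sigma> where "\<sigma> = sqrt ((t - s) * (Q x \<bullet> x))"
    have \<sigma>: "\<sigma> > 0" "\<sigma>\<^sup>2 = (t - s) * (Q x \<bullet> x)" using Qx st by (auto simp: \<sigma>_def)
    have D: "distributed M lborel ?X (normal_density 0 \<sigma>)"
      using law False by (simp add: \<sigma>_def)
    have E: "expectation ?X = 0" by (rule normal_distributed_expectation[OF \<sigma>(1) D])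
    have "integrable lborel (\<lambda>x. normal_density 0 \<sigma> x * x\<^sup>2)"
      using integrable_normal_moment[OF \<sigma>(1), of 0 2] by simp
    then have "integrable M (\<lambda>\<omega>. (?X \<omega>)\<^sup>2)"
      using distributed_integrable[OF D, of "\<lambda>x. x\<^sup>2"] by simp
    then show ?thesis
      using normal_distributed_variance[OF \<sigma>(1) D] E \<sigma>(2) by simp
  qed
  then show "integrable M (\<lambda>\<omega>. (W t x \<omega> - W s x \<omega>)\<^sup>2)"
    and "expectation (\<lambda>\<omega>. W t x \<omega> - W s x \<omega>) = 0"
    and "expectation (\<lambda>\<omega>. (W t x \<omega> - W s x \<omega>)\<^sup>2) = (t - s) * (Q x \<bullet> x)" by auto
qed

lemma W_moments:
  assumes t: "0 \<le> t"
  shows "integrable M (\<lambda>\<omega>. (W t x \<omega>)\<^sup>2)"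
    and "expectation (W t x) = 0"
    and "expectation (\<lambda>\<omega>. (W t x \<omega>)\<^sup>2) = t * (Q x \<bullet> x)"
proof -
  note [measurable] = W_measurable[OF t] W_measurable[of 0]
  have "integrable M (\<lambda>\<omega>. (W t x \<omega>)\<^sup>2) \<and> expectation (W t x) = 0 \<and>
    expectation (\<lambda>\<omega>. (W t x \<omega>)\<^sup>2) = t * (Q x \<bullet> x)"
  proof (cases "t = 0")
    case True
    have "integrable M (\<lambda>\<omega>. (W t x \<omega>)\<^sup>2) \<longleftrightarrow> integrable M (\<lambda>\<omega>. 0 :: real)"
      using W_0[of x] True by (intro integrable_cong_AE) auto
    moreover have "expectation (W t x) = expectation (\<lambda>\<omega>. 0)"
      using W_0[of x] True by (intro integral_cong_AE) auto
    moreover have "expectation (\<lambda>\<omega>. (W t x \<omega>)\<^sup>2) = expectation (\<lambda>\<omega>. 0)"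
      using W_0[of x] True by (intro integral_cong_AE) auto
    ultimately show ?thesis using True by simp
  next
    case False
    then have t': "0 < t" using t by simp
    note m = increment_moments[OF order_refl t', of x]
    have "integrable M (\<lambda>\<omega>. (W t x \<omega>)\<^sup>2) \<longleftrightarrow> integrable M (\<lambda>\<omega>. (W t x \<omega> - W 0 x \<omega>)\<^sup>2)"
      using W_0[of x] by (intro integrable_cong_AE) auto
    moreover have "expectation (W t x) = expectation (\<lambda>\<omega>. W t x \<omega> - W 0 x \<omega>)"
      using W_0[of x] by (intro integral_cong_AE) auto
    moreover have "expectation (\<lambda>\<omega>. (W t x \<omega>)\<^sup>2) = expectation (\<lambda>\<omega>. (W t x \<omega> - W 0 x \<omega>)\<^sup>2)"
      using W_0[of x] by (intro integral_cong_AE) auto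
    ultimately show ?thesis using m by simp
  qed
  then show "integrable M (\<lambda>\<omega>. (W t x \<omega>)\<^sup>2)"
    and "expectation (W t x) = 0"
    and "expectation (\<lambda>\<omega>. (W t x \<omega>)\<^sup>2) = t * (Q x \<bullet> x)" by auto
qed

lemma W_product_integrable:
  "0 \<le> s \<Longrightarrow> 0 \<le> t \<Longrightarrow> integrable M (\<lambda>\<omega>. W s x \<omega> * W t y \<omega>)"
  by (intro square_integrable_mult W_measurable W_moments)

lemma W_integrable: "0 \<le> t \<Longrightarrow> integrable M (W t x)"
  using square_integrable_imp_integrable[OF W_measurable W_moments(1)] by blast

text \<open>Polarization, using linearity in \<open>x\<close>.\<close>

lemma W_covariance_same_time:
  assumes t: "0 \<le> t"
  shows "expectation (\<lambda>\<omega>. W t x \<omega> * W t y \<omega>) = t * (Q x \<bullet> y)"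
proof -
  note [measurable] = W_measurable[OF t]
  have "t * (Q (x + y) \<bullet> (x + y)) = expectation (\<lambda>\<omega>. (W t (x + y) \<omega>)\<^sup>2)"
    by (simp add: W_moments[OF t])
  also have "\<dots> = expectation (\<lambda>\<omega>. (W t x \<omega>)\<^sup>2 + 2 * (W t x \<omega> * W t y \<omega>) + (W t y \<omega>)\<^sup>2)"
    using W_add[OF t, of x y] by (intro integral_cong_AE) (auto simp: power2_sum)
  also have "\<dots> = t * (Q x \<bullet> x) + 2 * expectation (\<lambda>\<omega>. W t x \<omega> * W t y \<omega>) + t * (Q y \<bullet> y)"
    using t by (simp add: W_moments W_product_integrable)
  finally have "2 * expectation (\<lambda>\<omega>. W t x \<omega> * W t y \<omega>) = t * (Q x \<bullet> y + Q y \<bullet> x)"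
    by (simp add: blinfun.add_right inner_add_left inner_add_right algebra_simps)
  also have "Q y \<bullet> x = Q x \<bullet> y" using sa by (metis self_adjoint_def inner_commute)
  finally show ?thesis by simp
qed

lemma W_increment_uncorrelated:
  assumes st: "0 \<le> s" "s < t"
  shows "expectation (\<lambda>\<omega>. W s x \<omega> * (W t y \<omega> - W s y \<omega>)) = 0"
proof -
  let ?X = "\<lambda>\<omega>. W t y \<omega> - W s y \<omega>"
  have t: "0 \<le> t" using st by simp
  note [measurable] = W_measurable[OF st(1)] W_measurable[OF t]
  have ind: "indep_set (sets (F s)) (sets (vimage_algebra (space M) ?X borel))"
    using wiener st unfolding cylindrical_Wiener_def by blast
  have sF: "space (F s) = space M"
    using filtration st(1) by (auto simp: normal_filtration_def subalgebra_def)
  have "indep_var borel (W s x) borel ?X"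
    unfolding indep_var_eq
  proof (intro conjI)
    show "indep_set (sigma_sets (space M) {W s x -` A \<inter> space M |A. A \<in> sets borel})
        (sigma_sets (space M) {?X -` A \<inter> space M |A. A \<in> sets borel})"
      unfolding indep_set_def
    proof (rule indep_sets_mono_sets[OF ind[unfolded indep_set_def]], clarsimp split: bool.split, intro conjI impI)
      have "sigma_sets (space (F s)) {W s x -` A \<inter> space M |A. A \<in> sets borel} \<subseteq> sets (F s)"
        using measurable_sets[OF W_adapted[OF st(1), of x]] sF
        by (intro sets.sigma_sets_subset) auto
      then show "sigma_sets (space M) {W s x -` A \<inter> space M |A. A \<in> sets borel} \<subseteq> sets (F s)"
        by (simp add: sF)
      show "sigma_sets (space M) {?X -` A \<inter> space M |A. A \<in> sets borel}
          \<subseteq> sets (vimage_algebra (space M) ?X borel)"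
        by (simp add: sets_vimage_algebra)
    qed
  qed measurable
  then have "expectation (\<lambda>\<omega>. W s x \<omega> * ?X \<omega>) = expectation (W s x) * expectation ?X"
    using W_integrable st t by (intro indep_var_lebesgue_integral) auto
  then show ?thesis using W_moments(2)[OF st(1)] by simp
qed

text \<open>For \<open>s \<le> t\<close> the increment after time \<open>s\<close> is independent of the past, so only the covariance
  at time \<open>s\<close> remains.\<close>

lemma W_covariance:
  assumes "0 \<le> s" "0 \<le> t"
  shows "expectation (\<lambda>\<omega>. W s x \<omega> * W t y \<omega>) = min s t * (Q x \<bullet> y)"
proof -
  have *: "expectation (\<lambda>\<omega>. W s x \<omega> * W t y \<omega>) = s * (Q x \<bullet> y)" if st: "0 \<le> s" "s \<le> t" for s t x y
  proof (cases "s = t")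
    case True
    then show ?thesis using W_covariance_same_time st by simp
  next
    case False
    have "expectation (\<lambda>\<omega>. W s x \<omega> * W t y \<omega>) =
        expectation (\<lambda>\<omega>. W s x \<omega> * (W t y \<omega> - W s y \<omega>) + W s x \<omega> * W s y \<omega>)"
      by (simp add: algebra_simps)
    also have "\<dots> = expectation (\<lambda>\<omega>. W s x \<omega> * (W t y \<omega> - W s y \<omega>)) + expectation (\<lambda>\<omega>. W s x \<omega> * W s y \<omega>)"
      using st by (intro Bochner_Integration.integral_add) (auto simp: right_diff_distrib W_product_integrable)
    finally show ?thesis
      using W_increment_uncorrelated[of s t x y] W_covariance_same_time[of s x y] False st by simp
  qed
  show ?thesis
  proof (cases "s \<le> t")
    case True then show ?thesis using * assms by simp
  next
    case False
    have "Q y \<bullet> x = Q x \<bullet> y" using sa by (metis self_adjoint_def inner_commute)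
    then show ?thesis using *[of t s y x] False assms by (simp add: mult.commute)
  qed
qed

text \<open>The covariance is written as a time integral so that a bilinear expansion of an elementary
  integral yields the isometry.\<close>

lemma increment_covariance:
  assumes "0 \<le> a" "a \<le> b" "0 \<le> a'" "a' \<le> b'"
  shows "integrable M (\<lambda>\<omega>. (W b x \<omega> - W a x \<omega>) * (W b' y \<omega> - W a' y \<omega>))" (is ?I)
    and "expectation (\<lambda>\<omega>. (W b x \<omega> - W a x \<omega>) * (W b' y \<omega> - W a' y \<omega>)) =
      (\<integral>s. (indicat_real {a<..b} s * indicat_real {a'<..b'} s) * (Q x \<bullet> y) \<partial>lborel)" (is "?E = _")
proof -
  have pos: "0 \<le> b" "0 \<le> b'" using assms by auto
  have eq: "(W b x \<omega> - W a x \<omega>) * (W b' y \<omega> - W a' y \<omega>) =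
      W b x \<omega> * W b' y \<omega> - W b x \<omega> * W a' y \<omega> - W a x \<omega> * W b' y \<omega> + W a x \<omega> * W a' y \<omega>" for \<omega>
    by (simp add: algebra_simps)
  show ?I unfolding eq using assms pos by (simp add: W_product_integrable)
  have "?E = min b b' * (Q x \<bullet> y) - min b a' * (Q x \<bullet> y) - min a b' * (Q x \<bullet> y) + min a a' * (Q x \<bullet> y)"
    unfolding eq using assms(1,3) pos by (simp add: W_product_integrable W_covariance)
  also have "\<dots> = (min b b' - min b a' - min a b' + min a a') * (Q x \<bullet> y)"
    by (simp only: left_diff_distrib distrib_right)
  also have "\<dots> = (\<integral>s. (indicat_real {a<..b} s * indicat_real {a'<..b'} s) * (Q x \<bullet> y) \<partial>lborel)"
    using has_bochner_integral_integral_eq[OF min_increments_eq_overlap[OF assms(2,4)]] by simp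
  finally show "?E = (\<integral>s. (indicat_real {a<..b} s * indicat_real {a'<..b'} s) * (Q x \<bullet> y) \<partial>lborel)" .
qed

end

section \<open>The Ito isometry in weak form\<close>

lemma integral_double_sum:
  fixes g :: "nat \<Rightarrow> nat \<Rightarrow> 'a \<Rightarrow> real"
  assumes g: "\<And>i j. i < n \<Longrightarrow> j < n \<Longrightarrow> integrable N (g i j)"
  shows "(\<integral>x. (\<Sum>i<n. \<Sum>j<n. c i j * g i j x) \<partial>N) = (\<Sum>i<n. \<Sum>j<n. c i j * (\<integral>x. g i j x \<partial>N))"
proof -
  have "(\<integral>x. (\<Sum>i<n. \<Sum>j<n. c i j * g i j x) \<partial>N) = (\<Sum>i<n. \<integral>x. (\<Sum>j<n. c i j * g i j x) \<partial>N)"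
    using g by (intro Bochner_Integration.integral_sum) auto
  also have "\<dots> = (\<Sum>i<n. \<Sum>j<n. \<integral>x. c i j * g i j x \<partial>N)"
    using g by (intro sum.cong refl Bochner_Integration.integral_sum) auto
  finally show ?thesis by simp
qed

text \<open>Exchanging \<open>h\<close> and \<open>f\<close> turns each \<open>(_, h) f\<close> into its adjoint \<open>(_, f) h\<close>.\<close>

definition transpose_elementary :: "'h elementary \<Rightarrow> 'h elementary" where
  "transpose_elementary = map (\<lambda>(a, b, h, f). (a, b, f, h))"

lemma elementary_fun_transpose:
  "elementary_fun L s u \<bullet> v = u \<bullet> elementary_fun (transpose_elementary L) s v"
  unfolding transpose_elementary_def elementary_fun_def
  by (induction L)
    (auto simp: blinfun.add_left blinfun.scaleR_left inner_add_left inner_add_right inner_commute)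

lemma elementary_upto_transpose:
  "elementary_upto t L \<Longrightarrow> elementary_upto t (transpose_elementary L)"
  by (induction L) (auto simp: elementary_upto_def transpose_elementary_def)

lemma elementary_fun_apply:
  "elementary_fun L s v = (\<Sum>(a, b, h, f)\<leftarrow>L. (indicat_real {a<..b} s * (h \<bullet> v)) *\<^sub>R f)"
  unfolding elementary_fun_def
  by (induction L) (auto simp: blinfun.add_left blinfun.scaleR_left inner_commute)

lemma blinfun_apply_measurable [measurable (raw)]:
  fixes R :: "'h::{real_normed_vector,second_countable_topology} \<Rightarrow>\<^sub>L 'h"
  assumes "h \<in> borel_measurable N"
  shows "(\<lambda>s. R (h s)) \<in> borel_measurable N"
  using assms by (rule measurable_compose) (intro borel_measurable_continuous_onI continuous_intros)

lemma elementary_fun_measurable [measurable]: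
  "(\<lambda>s. elementary_fun L s (v :: 'h::{real_inner,second_countable_topology})) \<in> borel_measurable borel"
  unfolding elementary_fun_apply by (induction L) auto

lemma elementary_fun_eq_0:
  assumes "elementary_upto t L" "s \<notin> {0..t}"
  shows "elementary_fun L s = 0"
  using assms unfolding elementary_fun_def elementary_upto_def
  by (induction L) (auto simp: indicator_def split: if_splits)

context wiener
begin

text \<open>Testing against \<open>x\<close> reduces the isometry to a scalar double sum over pairs of entries of the
  list: on the left their increments are multiplied, on the right their time indicators.\<close>

lemma elementary_isometry:
  assumes L: "elementary_upto t L"
  shows "integrable M (\<lambda>\<omega>. (elementary_integral W L \<omega> \<bullet> x)\<^sup>2)" (is "integrable M ?X")
    and "expectation (\<lambda>\<omega>. elementary_integral W L \<omega> \<bullet> x) = 0"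
    and "integrable lborel (\<lambda>s. Q (elementary_fun (transpose_elementary L) s x) \<bullet>
        elementary_fun (transpose_elementary L) s x)" (is "integrable lborel ?Y")
    and "expectation (\<lambda>\<omega>. (elementary_integral W L \<omega> \<bullet> x)\<^sup>2) =
      (\<integral>s. Q (elementary_fun (transpose_elementary L) s x) \<bullet>
        elementary_fun (transpose_elementary L) s x \<partial>lborel)"
proof -
  define n where "n = length L"
  define a b h f where "a i = fst (L ! i)" and "b i = fst (snd (L ! i))"
    and "h i = fst (snd (snd (L ! i)))" and "f i = snd (snd (snd (L ! i)))" for i
  define c where "c i = f i \<bullet> x" for i
  define \<Delta> where "\<Delta> i \<omega> = W (b i) (h i) \<omega> - W (a i) (h i) \<omega>" for i \<omega>
  have ab: "0 \<le> a i" "a i \<le> b i" if "i < n" for i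
    using L nth_mem[of i L] that unfolding elementary_upto_def n_def a_def b_def
    by (auto simp: case_prod_unfold)
  have I: "elementary_integral W L \<omega> \<bullet> x = (\<Sum>i<n. c i * \<Delta> i \<omega>)" for \<omega>
    by (simp add: elementary_integral_def sum_list_sum_nth inner_sum_left case_prod_unfold n_def
        a_def b_def h_def f_def c_def \<Delta>_def atLeast0LessThan mult.commute)
  have T: "elementary_fun (transpose_elementary L) s x =
      (\<Sum>i<n. (indicat_real {a i<..b i} s * c i) *\<^sub>R h i)" for s
    by (simp add: elementary_fun_apply transpose_elementary_def sum_list_sum_nth case_prod_unfold n_def
        a_def b_def h_def f_def c_def atLeast0LessThan)
  have X: "(elementary_integral W L \<omega> \<bullet> x)\<^sup>2 = (\<Sum>i<n. \<Sum>j<n. c i * c j * (\<Delta> i \<omega> * \<Delta> j \<omega>))" for \<omega>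
    unfolding I power2_eq_square sum_product by (simp add: ac_simps)
  have Y: "?Y s = (\<Sum>i<n. \<Sum>j<n. c i * c j *
      (indicat_real {a i<..b i} s * indicat_real {a j<..b j} s * (Q (h i) \<bullet> h j)))" for s
    unfolding T blinfun.sum_right blinfun.scaleR_right inner_sum_left inner_sum_right
    by (subst sum.swap) (simp add: ac_simps sum_distrib_left)
  have cov: "integrable M (\<lambda>\<omega>. \<Delta> i \<omega> * \<Delta> j \<omega>)"
    "expectation (\<lambda>\<omega>. \<Delta> i \<omega> * \<Delta> j \<omega>) =
      (\<integral>s. indicat_real {a i<..b i} s * indicat_real {a j<..b j} s * (Q (h i) \<bullet> h j) \<partial>lborel)"
    if "i < n" "j < n" for i j
    unfolding \<Delta>_def using increment_covariance[OF ab[OF that(1)] ab[OF that(2)]] by auto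
  have ov: "integrable lborel (\<lambda>s. indicat_real {a i<..b i} s * indicat_real {a j<..b j} s * (Q (h i) \<bullet> h j))"
    if "i < n" "j < n" for i j
    using min_increments_eq_overlap[OF ab(2)[OF that(1)] ab(2)[OF that(2)]]
    by (intro integrable_mult_left) (rule integrable.intros)
  show "integrable M ?X"
    unfolding X by (intro Bochner_Integration.integrable_sum integrable_mult_right cov) auto
  show "integrable lborel ?Y"
    unfolding Y by (intro Bochner_Integration.integrable_sum integrable_mult_right ov) auto
  have \<Delta>: "integrable M (\<Delta> i)" "expectation (\<Delta> i) = 0" if "i < n" for i
    using ab[OF that] unfolding \<Delta>_def[abs_def]
    by (auto simp: W_integrable W_moments(2))
  show "expectation (\<lambda>\<omega>. elementary_integral W L \<omega> \<bullet> x) = 0"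
    unfolding I using \<Delta> by (subst Bochner_Integration.integral_sum) auto
  show "expectation ?X = (\<integral>s. ?Y s \<partial>lborel)"
    unfolding X Y
    using integral_double_sum[of n M "\<lambda>i j \<omega>. \<Delta> i \<omega> * \<Delta> j \<omega>" "\<lambda>i j. c i * c j", OF cov(1)]
      integral_double_sum[of n lborel "\<lambda>i j s. indicat_real {a i<..b i} s * indicat_real {a j<..b j} s *
        (Q (h i) \<bullet> h j)" "\<lambda>i j. c i * c j", OF ov]
    by (simp add: cov(2))
qed

lemma elementary_integral_measurable [measurable]:
  "elementary_upto t L \<Longrightarrow> elementary_integral W L \<in> borel_measurable M"
  unfolding elementary_integral_def[abs_def] elementary_upto_def
proof (induction L)
  case (Cons l L)
  obtain a b h f where l: "l = (a, b, h, f)" by (metis prod.exhaust)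
  then have "0 \<le> a" "0 \<le> b" using Cons.prems by auto
  note [measurable] = W_measurable[OF this(1)] W_measurable[OF this(2)]
  have "(\<lambda>\<omega>. \<Sum>(a, b, h, f)\<leftarrow>L. (W b h \<omega> - W a h \<omega>) *\<^sub>R f) \<in> borel_measurable M"
    using Cons by auto
  then show ?case unfolding l by simp
qed simp

text \<open>For \<open>T = (\<Phi> - \<Phi>\<^sub>n) Q\<^sup>1\<^sup>/\<^sup>2\<close> the adjoint is \<open>U = Q\<^sup>1\<^sup>/\<^sup>2 (\<Phi> - \<Phi>\<^sub>n\<^sup>*)\<close>, so
  \<open>\<parallel>U x\<parallel>\<^sup>2 \<le> \<parallel>T\<parallel>\<^sup>2 \<parallel>x\<parallel>\<^sup>2\<close> is at most \<open>\<parallel>x\<parallel>\<^sup>2\<close> times the squared Hilbert--Schmidt norm of \<open>T\<close>. Hence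
  \<open>Q\<^sup>1\<^sup>/\<^sup>2 \<Phi>\<^sub>n\<^sup>* x\<close> converges to \<open>Q\<^sup>1\<^sup>/\<^sup>2 \<Phi> x\<close> in \<open>L\<^sup>2(0, t; H)\<close>, and the isometry for elementary integrands
  passes to the limit.\<close>

lemma stoch_integral_moments:
  assumes J: "has_stoch_integral M Q W t \<Phi> J" and t: "0 \<le> t"
    and sa\<Phi>: "\<And>s. s \<in> {0..t} \<Longrightarrow> self_adjoint (\<Phi> s)"
    and meas: "(\<lambda>s. indicat_real {0..t} s *\<^sub>R \<Phi> s x) \<in> borel_measurable borel"
  shows "integrable M (\<lambda>\<omega>. (J \<omega> \<bullet> x)\<^sup>2)"
    and "expectation (\<lambda>\<omega>. J \<omega> \<bullet> x) = 0"
    and "expectation (\<lambda>\<omega>. (J \<omega> \<bullet> x)\<^sup>2) = (\<integral>s. indicat_real {0..t} s * (Q (\<Phi> s x) \<bullet> \<Phi> s x) \<partial>lborel)"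
proof -
  let ?R = "op_sqrt Q"
  note [measurable] = meas
  have JM[measurable]: "J \<in> borel_measurable M"
    using J by (simp add: has_stoch_integral_def)
  obtain L where L: "\<And>n. elementary_upto t (L n)"
    and lim\<Phi>: "(\<lambda>n. \<integral>\<^sup>+ s\<in>{0..t}. hs_norm_sq ((\<Phi> s - elementary_fun (L n) s) o\<^sub>L ?R) \<partial>lborel)
           \<longlonglongrightarrow> 0"
    and limJ: "(\<lambda>n. \<integral>\<^sup>+ \<omega>. ennreal ((norm (J \<omega> - elementary_integral W (L n) \<omega>))\<^sup>2) \<partial>M) \<longlonglongrightarrow> 0"
    using J unfolding has_stoch_integral_def by blast
  note iso = elementary_isometry[OF L, of _ x]
  note [measurable] = elementary_integral_measurable[OF L]
  \<comment> \<open>A positive bound for \<open>\<parallel>x\<parallel>\<^sup>2\<close>, to avoid the case \<open>x = 0\<close>.\<close>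
  define c where "c = (norm x)\<^sup>2 + 1"
  have c: "c > 0" "(norm x)\<^sup>2 \<le> c" by (auto simp: c_def add_nonneg_pos)
  have dom: "(\<lambda>n. G n) \<longlonglongrightarrow> 0" if "\<And>n. G n \<le> ennreal c * H n" "(\<lambda>n. H n) \<longlonglongrightarrow> 0" for G H :: "nat \<Rightarrow> ennreal"
  proof (rule tendsto_sandwich[OF _ _ tendsto_const])
    show "(\<lambda>n. ennreal c * H n) \<longlonglongrightarrow> 0"
      using tendsto_mult_ennreal[OF tendsto_const[of "ennreal c"] that(2)] by simp
  qed (use that in auto)

  have limX: "(\<lambda>n. \<integral>\<^sup>+ \<omega>. ennreal ((norm (J \<omega> \<bullet> x - elementary_integral W (L n) \<omega> \<bullet> x))\<^sup>2) \<partial>M) \<longlonglongrightarrow> 0"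
  proof (rule dom[OF _ limJ], rule nn_integral_le_cmult[OF c(1)])
    fix n \<omega>
    have "\<bar>(J \<omega> - elementary_integral W (L n) \<omega>) \<bullet> x\<bar>\<^sup>2 \<le> (norm (J \<omega> - elementary_integral W (L n) \<omega>) * norm x)\<^sup>2"
      by (intro power_mono Cauchy_Schwarz_ineq2) auto
    also have "\<dots> \<le> c * (norm (J \<omega> - elementary_integral W (L n) \<omega>))\<^sup>2"
      using c(2) by (simp add: power_mult_distrib mult.commute mult_right_mono)
    finally show "ennreal ((norm (J \<omega> \<bullet> x - elementary_integral W (L n) \<omega> \<bullet> x))\<^sup>2)
        \<le> ennreal c * ennreal ((norm (J \<omega> - elementary_integral W (L n) \<omega>))\<^sup>2)"
      using c(1) by (simp add: inner_diff_left ennreal_leI flip: ennreal_mult)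
  qed measurable
  have gX: "integrable M (\<lambda>\<omega>. (norm (elementary_integral W (L n) \<omega> \<bullet> x))\<^sup>2)" for n
    using iso(1) by simp
  have X: "integrable M (\<lambda>\<omega>. (norm (J \<omega> \<bullet> x))\<^sup>2)"
    "(\<lambda>n. expectation (\<lambda>\<omega>. (norm (elementary_integral W (L n) \<omega> \<bullet> x))\<^sup>2))
      \<longlonglongrightarrow> expectation (\<lambda>\<omega>. (norm (J \<omega> \<bullet> x))\<^sup>2)"
    by (rule mean_square_limit_norm[OF _ _ gX limX]; measurable)+
  show J2: "integrable M (\<lambda>\<omega>. (J \<omega> \<bullet> x)\<^sup>2)" using X(1) by simp
  have J1: "integrable M (\<lambda>\<omega>. J \<omega> \<bullet> x)"
    by (rule square_integrable_imp_integrable[OF _ J2]) measurable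
  have I1: "integrable M (\<lambda>\<omega>. elementary_integral W (L n) \<omega> \<bullet> x)" for n
    by (rule square_integrable_imp_integrable[OF _ iso(1)]) measurable
  \<comment> \<open>The mean is read off from \<open>E (J, x)\<^sup>2 + 2 E (J, x) + 1 = E ((J, x) + 1)\<^sup>2\<close>, whose right-hand side is again a mean-square limit.\<close>
  have g1: "integrable M (\<lambda>\<omega>. (norm (elementary_integral W (L n) \<omega> \<bullet> x + 1))\<^sup>2)" for n
    using iso(1) I1 by (simp add: power2_sum)
  have "(\<lambda>n. expectation (\<lambda>\<omega>. (norm (elementary_integral W (L n) \<omega> \<bullet> x + 1))\<^sup>2))
      \<longlonglongrightarrow> expectation (\<lambda>\<omega>. (norm (J \<omega> \<bullet> x + 1))\<^sup>2)"
    using limX by (intro mean_square_limit_norm(2)[OF _ _ g1]) (simp_all add: JM)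
  moreover have "expectation (\<lambda>\<omega>. (norm (elementary_integral W (L n) \<omega> \<bullet> x + 1))\<^sup>2) =
      expectation (\<lambda>\<omega>. (norm (elementary_integral W (L n) \<omega> \<bullet> x))\<^sup>2) + 1" for n
    using iso I1 by (simp add: power2_sum prob_space)
  moreover have "expectation (\<lambda>\<omega>. (norm (J \<omega> \<bullet> x + 1))\<^sup>2) =
      expectation (\<lambda>\<omega>. (norm (J \<omega> \<bullet> x))\<^sup>2) + 2 * expectation (\<lambda>\<omega>. J \<omega> \<bullet> x) + 1"
    using J1 J2 by (simp add: power2_sum prob_space)
  ultimately show "expectation (\<lambda>\<omega>. J \<omega> \<bullet> x) = 0"
    using LIMSEQ_unique[OF _ tendsto_add[OF X(2) tendsto_const[of 1]]] by fastforce

  define T where "T n = elementary_fun (transpose_elementary (L n))" for n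
  define f where "f s = ?R (indicat_real {0..t} s *\<^sub>R \<Phi> s x)" for s
  define g where "g n s = ?R (T n s x)" for n s
  have [measurable]: "f \<in> borel_measurable lborel" "g n \<in> borel_measurable lborel" for n
    unfolding f_def[abs_def] g_def[abs_def] T_def by measurable
  have T0: "T n s = 0" if "s \<notin> {0..t}" for n s
    unfolding T_def by (rule elementary_fun_eq_0[OF elementary_upto_transpose[OF L] that])
  have limY: "(\<lambda>n. \<integral>\<^sup>+ s. ennreal ((norm (f s - g n s))\<^sup>2) \<partial>lborel) \<longlonglongrightarrow> 0"
  proof (rule dom[OF _ lim\<Phi>], rule nn_integral_le_cmult[OF c(1)])
    fix n s
    show "ennreal ((norm (f s - g n s))\<^sup>2) \<le>
        ennreal c * (hs_norm_sq ((\<Phi> s - elementary_fun (L n) s) o\<^sub>L ?R) * indicator {0..t} s)"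
    proof (cases "s \<in> {0..t}")
      case False
      then show ?thesis by (simp add: f_def g_def T0)
    next
      case True
      let ?T = "(\<Phi> s - elementary_fun (L n) s) o\<^sub>L ?R" and ?U = "?R o\<^sub>L (\<Phi> s - T n s)"
      have "?T u \<bullet> v = u \<bullet> ?U v" for u v
      proof -
        have "?T u \<bullet> v = \<Phi> s (?R u) \<bullet> v - elementary_fun (L n) s (?R u) \<bullet> v"
          by (simp add: blinfun.diff_left inner_diff_left)
        also have "\<dots> = ?R u \<bullet> (\<Phi> s v - T n s v)"
          using sa\<Phi>[OF True] by (simp add: elementary_fun_transpose T_def self_adjoint_def inner_diff_right)
        also have "\<dots> = u \<bullet> ?U v"
          using op_sqrt(1)[OF sa sp] by (simp add: self_adjoint_def blinfun.diff_left)
        finally show ?thesis .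
      qed
      then have "norm ?U \<le> norm ?T" by (rule norm_le_norm_of_adjoint_pair)
      have "norm (f s - g n s) = norm (?U x)"
        using True by (simp add: f_def g_def blinfun.diff_left blinfun.diff_right)
      also have "\<dots> \<le> norm ?T * norm x"
        by (rule order_trans[OF norm_blinfun mult_right_mono[OF \<open>norm ?U \<le> norm ?T\<close> norm_ge_zero]])
      finally have "(norm (f s - g n s))\<^sup>2 \<le> (norm ?T * norm x)\<^sup>2"
        by (intro power_mono) auto
      also have "\<dots> \<le> c * (norm ?T)\<^sup>2"
        using c(2) by (simp add: power_mult_distrib mult.commute mult_right_mono)
      finally have "ennreal ((norm (f s - g n s))\<^sup>2) \<le> ennreal c * ennreal ((norm ?T)\<^sup>2)"
        using c(1) by (simp add: ennreal_leI flip: ennreal_mult)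
      also have "\<dots> \<le> ennreal c * hs_norm_sq ?T"
        by (intro mult_left_mono norm_sq_le_hs_norm_sq) auto
      finally show ?thesis using True by simp
    qed
  qed measurable
  have gY: "integrable lborel (\<lambda>s. (norm (g n s))\<^sup>2)" for n
    using iso(3) by (simp add: g_def norm_op_sqrt[OF sa sp] T_def)
  have "(\<lambda>n. \<integral>s. (norm (g n s))\<^sup>2 \<partial>lborel) \<longlonglongrightarrow> (\<integral>s. (norm (f s))\<^sup>2 \<partial>lborel)"
    by (rule mean_square_limit_norm(2)[OF _ _ gY limY]; measurable)
  moreover have "(\<integral>s. (norm (g n s))\<^sup>2 \<partial>lborel) = expectation (\<lambda>\<omega>. (norm (elementary_integral W (L n) \<omega> \<bullet> x))\<^sup>2)" for n
    using iso(4) by (simp add: g_def norm_op_sqrt[OF sa sp] T_def)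
  ultimately have "expectation (\<lambda>\<omega>. (norm (J \<omega> \<bullet> x))\<^sup>2) = (\<integral>s. (norm (f s))\<^sup>2 \<partial>lborel)"
    using LIMSEQ_unique[OF X(2)] by simp
  also have "\<dots> = (\<integral>s. indicat_real {0..t} s * (Q (\<Phi> s x) \<bullet> \<Phi> s x) \<partial>lborel)"
    unfolding f_def norm_op_sqrt[OF sa sp]
    by (intro Bochner_Integration.integral_cong) (auto simp: indicator_def)
  finally show "expectation (\<lambda>\<omega>. (J \<omega> \<bullet> x)\<^sup>2) = (\<integral>s. indicat_real {0..t} s * (Q (\<Phi> s x) \<bullet> \<Phi> s x) \<partial>lborel)"
    by simp
qed

end

section \<open>Strong integrals of operator families\<close>

text \<open>The integral is taken vector by vector, as in the definition of \<open>neg_power\<close>: a Bochner integral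
  needs a second countable target, and the space of operators with the operator norm is in
  general not separable.\<close>

definition strong_integral ::
    "'s measure \<Rightarrow> ('s \<Rightarrow> 'h::{banach,second_countable_topology} \<Rightarrow>\<^sub>L 'h) \<Rightarrow> 'h \<Rightarrow>\<^sub>L 'h" where
  "strong_integral N T = Blinfun (\<lambda>x. \<integral>r. T r x \<partial>N)"

context
  fixes N :: "'s measure" and T :: "'s \<Rightarrow> 'h::{banach,second_countable_topology} \<Rightarrow>\<^sub>L 'h" and g :: "'s \<Rightarrow> real"
  assumes meas: "\<And>x. (\<lambda>r. T r x) \<in> borel_measurable N"
    and int: "integrable N g" and le: "\<And>r. norm (T r) \<le> g r"
begin

lemma strongly_integrable: "integrable N (\<lambda>r. T r x)"
proof (rule Bochner_Integration.integrable_bound)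
  show "integrable N (\<lambda>r. g r * norm x)" using int by simp
  have "norm (T r x) \<le> g r * norm x" for r
    by (rule order_trans[OF norm_blinfun mult_right_mono[OF le norm_ge_zero]])
  then show "AE r in N. norm (T r x) \<le> norm (g r * norm x)"
    by (auto intro!: AE_I2 intro: order_trans[OF _ abs_ge_self])
qed (rule meas)

lemma norm_strong_integral_apply_le: "norm (\<integral>r. T r x \<partial>N) \<le> (\<integral>r. g r \<partial>N) * norm x"
proof -
  have "norm (\<integral>r. T r x \<partial>N) \<le> (\<integral>r. norm (T r x) \<partial>N)"
    by (rule integral_norm_bound)
  also have "\<dots> \<le> (\<integral>r. g r * norm x \<partial>N)"
    using int strongly_integrable
    by (intro integral_mono integrable_norm integrable_mult_left)
      (auto intro: order_trans[OF norm_blinfun mult_right_mono[OF le norm_ge_zero]])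
  finally show ?thesis by simp
qed

lemma strong_integral_apply: "strong_integral N T x = (\<integral>r. T r x \<partial>N)"
proof -
  have "bounded_linear (\<lambda>x. \<integral>r. T r x \<partial>N)"
    by (rule bounded_linear_intro[where K = "\<integral>r. g r \<partial>N"])
      (use strongly_integrable norm_strong_integral_apply_le in
        \<open>auto simp: blinfun.add_right blinfun.scaleR_right mult.commute\<close>)
  then show ?thesis by (simp add: strong_integral_def bounded_linear_Blinfun_apply)
qed

lemma norm_strong_integral_le: "norm (strong_integral N T) \<le> (\<integral>r. g r \<partial>N)"
proof (rule norm_blinfun_bound)
  show "0 \<le> (\<integral>r. g r \<partial>N)" using order_trans[OF norm_ge_zero le] by simp
qed (simp add: strong_integral_apply norm_strong_integral_apply_le)

end


section \<open>Self-adjoint semigroups commuting with \<open>Q\<close>\<close>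

text \<open>The complexification of \<open>S\<close> is the restriction of an operator-valued differentiable function, and
  complexification does not decrease distances.\<close>

lemma bounded_analytic_norm_continuous:
  fixes S :: "real \<Rightarrow> 'h::real_normed_vector \<Rightarrow>\<^sub>L 'h"
  assumes "bounded_analytic S"
  shows "continuous_on {0<..} S"
proof -
  obtain \<omega> F where \<omega>: "\<omega> > 0" and F: "op_holomorphic_on F (sector \<omega>)"
    and FS: "\<And>t. t > 0 \<Longrightarrow> F (complex_of_real t) = complexify (S t)"
    using assms unfolding bounded_analytic_def by auto
  have contF: "continuous_on (sector \<omega>) F"
    using F unfolding op_holomorphic_on_def
    by (auto simp: continuous_on_eq_continuous_within intro: has_derivative_continuous)
  have "complex_of_real ` {0<..} \<subseteq> sector \<omega>"
    using \<omega> by (auto simp: sector_def Arg_of_real)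
  from continuous_on_compose2[OF contF continuous_on_of_real[OF continuous_on_id] this]
  have "continuous_on {0<..} (\<lambda>t. F (complex_of_real t))" .
  then have cont: "continuous_on {0<..} (\<lambda>t. complexify (S t))"
    by (rule continuous_on_eq) (simp add: FS)
  have "dist (S t) (S u) \<le> dist (complexify (S t)) (complexify (S u))" for t u
    unfolding dist_norm
  proof (rule norm_blinfun_bound)
    fix x :: 'h
    have "norm ((S t - S u) x) = norm ((complexify (S t) - complexify (S u)) (x, 0))"
      by (simp add: blinfun.diff_left norm_Pair)
    also have "\<dots> \<le> norm (complexify (S t) - complexify (S u)) * norm (x, 0 :: 'h)"
      by (rule norm_blinfun)
    finally show "norm ((S t - S u) x) \<le> norm (complexify (S t) - complexify (S u)) * norm x"
      by (simp add: norm_Pair)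
  qed simp
  then show ?thesis
    using cont unfolding continuous_on_iff by (metis le_less_trans)
qed

lemma Gamma_duplication_real:
  fixes z :: real
  assumes "z > 0"
  shows "Gamma z * Gamma (z + 1/2) = 2 powr (1 - 2 * z) * sqrt pi * Gamma (2 * z)"
proof -
  have nz: "complex_of_real z \<notin> \<int>\<^sub>\<le>\<^sub>0" "complex_of_real z + 1/2 \<notin> \<int>\<^sub>\<le>\<^sub>0"
    using assms by (auto elim!: nonpos_Ints_cases simp: complex_eq_iff)
  have e: "exp ((1 - 2 * complex_of_real z) * of_real (ln 2)) = of_real (2 powr (1 - 2 * z))"
    by (simp add: powr_def flip: exp_of_real)
  have "complex_of_real (Gamma z * Gamma (z + 1/2)) =
      complex_of_real (2 powr (1 - 2 * z) * sqrt pi * Gamma (2 * z))"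
    using Gamma_legendre_duplication[OF nz] unfolding e
    by (simp add: Gamma_complex_of_real[symmetric])
  then show ?thesis by (simp only: of_real_eq_iff)
qed

text \<open>Norm continuity on \<open>(0, \<infinity>)\<close> stands in for analyticity.\<close>

locale selfadjoint_semigroup =
  fixes Q :: "'h::{real_inner,banach,second_countable_topology} \<Rightarrow>\<^sub>L 'h"
    and S :: "real \<Rightarrow> 'h \<Rightarrow>\<^sub>L 'h"
    and \<gamma> :: real
  assumes Q_sa: "self_adjoint Q"
    and Q_sp: "strictly_positive Q"
    and semigroup: "C0_semigroup S"
    and S_cont: "continuous_on {0<..} S"
    and S_sa: "\<And>t. 0 \<le> t \<Longrightarrow> self_adjoint (S t)"
    and S_comm: "\<And>t. 0 \<le> t \<Longrightarrow> S t o\<^sub>L Q = Q o\<^sub>L S t"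
    and \<gamma>: "\<gamma> > 1 / 2"
    and hs_finite:
      "(\<integral>\<^sup>+ t\<in>{0<..}. hs_norm_sq (t powr (\<gamma> - 1) *\<^sub>R (S t o\<^sub>L op_sqrt Q)) \<partial>lborel) < \<infinity>"
begin

lemma S_double: "0 \<le> r \<Longrightarrow> S (2 * r) = S r o\<^sub>L S r"
  using semigroup unfolding C0_semigroup_def by (metis mult_2)

lemma powr_double: "r powr (\<gamma> - 1) * r powr (\<gamma> - 1) = r powr (2 * \<gamma> - 2)"
  by (simp flip: powr_add)

text \<open>Strict positivity bounds \<open>S(t)\<close> by \<open>Q\<^sup>1\<^sup>/\<^sup>2 S(t)\<close>, which is the adjoint of \<open>S(t) Q\<^sup>1\<^sup>/\<^sup>2\<close>.\<close>

lemma norm_S_le_hs: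
  obtains \<theta> where "\<theta> > 0" "\<And>t. 0 \<le> t \<Longrightarrow>
    ennreal (\<theta> * (t powr (2 * \<gamma> - 2) * (norm (S t))\<^sup>2)) \<le> hs_norm_sq (t powr (\<gamma> - 1) *\<^sub>R (S t o\<^sub>L op_sqrt Q))"
proof -
  let ?R = "op_sqrt Q"
  obtain \<theta> where \<theta>: "\<theta> > 0" "\<And>x. Q x \<bullet> x \<ge> \<theta> * (norm x)\<^sup>2"
    using Q_sp by (auto simp: strictly_positive_def)
  have "ennreal (\<theta> * (t powr (2 * \<gamma> - 2) * (norm (S t))\<^sup>2)) \<le> hs_norm_sq (t powr (\<gamma> - 1) *\<^sub>R (S t o\<^sub>L ?R))"
    if t: "0 \<le> t" for t
  proof -
    have "(S t o\<^sub>L ?R) u \<bullet> v = u \<bullet> (?R o\<^sub>L S t) v" for u v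
      using S_sa[OF t] op_sqrt(1)[OF Q_sa Q_sp] by (simp add: self_adjoint_def)
    then have le: "norm (?R o\<^sub>L S t) \<le> norm (S t o\<^sub>L ?R)" by (rule norm_le_norm_of_adjoint_pair)
    have "sqrt \<theta> * norm (S t x) \<le> norm (?R o\<^sub>L S t) * norm x" for x
    proof -
      have "(sqrt \<theta> * norm (S t x))\<^sup>2 \<le> Q (S t x) \<bullet> S t x"
        using \<theta> by (simp add: power_mult_distrib)
      also have "\<dots> = (norm ((?R o\<^sub>L S t) x))\<^sup>2"
        by (simp add: norm_op_sqrt[OF Q_sa Q_sp])
      finally have "sqrt \<theta> * norm (S t x) \<le> norm ((?R o\<^sub>L S t) x)"
        by (rule power2_le_imp_le) simp
      then show ?thesis using norm_blinfun[of "?R o\<^sub>L S t" x] by linarith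
    qed
    then have "norm (S t x) \<le> (norm (?R o\<^sub>L S t) / sqrt \<theta>) * norm x" for x
      using \<theta>(1) by (simp add: pos_le_divide_eq mult.commute)
    then have "norm (S t) \<le> norm (?R o\<^sub>L S t) / sqrt \<theta>"
      using \<theta>(1) by (intro norm_blinfun_bound) auto
    then have "sqrt \<theta> * norm (S t) \<le> norm (S t o\<^sub>L ?R)"
      using \<theta>(1) le by (simp add: pos_le_divide_eq mult.commute)
    then have "t powr (\<gamma> - 1) * (sqrt \<theta> * norm (S t)) \<le> t powr (\<gamma> - 1) * norm (S t o\<^sub>L ?R)"
      by (intro mult_left_mono) auto
    then have "t powr (\<gamma> - 1) * (sqrt \<theta> * norm (S t)) \<le> norm (t powr (\<gamma> - 1) *\<^sub>R (S t o\<^sub>L ?R))"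
      by simp
    then have "(t powr (\<gamma> - 1) * (sqrt \<theta> * norm (S t)))\<^sup>2 \<le> (norm (t powr (\<gamma> - 1) *\<^sub>R (S t o\<^sub>L ?R)))\<^sup>2"
      using \<theta>(1) by (intro power_mono) auto
    also have "(t powr (\<gamma> - 1) * (sqrt \<theta> * norm (S t)))\<^sup>2 = \<theta> * (t powr (2 * \<gamma> - 2) * (norm (S t))\<^sup>2)"
      using \<theta>(1) powr_double[of t] by (simp add: power_mult_distrib) (simp add: power2_eq_square)
    finally show ?thesis
      by (rule order_trans[OF ennreal_leI norm_sq_le_hs_norm_sq])
  qed
  then show thesis using that \<theta>(1) by blast
qed

text \<open>The integrable majorant for all the operator integrals below.\<close>

definition weight :: "real \<Rightarrow> real" where
  "weight r = indicat_real {0<..} r * (r powr (2 * \<gamma> - 2) * (norm (S r))\<^sup>2)"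

lemma weight_integrable: "integrable lborel weight"
proof -
  have "(\<lambda>r. indicat_real {0<..} r *\<^sub>R (norm (S r))\<^sup>2) \<in> borel_measurable borel"
    by (intro borel_measurable_continuous_on_indicator continuous_intros S_cont) auto
  then have [measurable]: "(\<lambda>r. r powr (2 * \<gamma> - 2) * (indicat_real {0<..} r *\<^sub>R (norm (S r))\<^sup>2)) \<in> borel_measurable borel"
    by measurable
  then have w[measurable]: "weight \<in> borel_measurable lborel"
    by (simp add: weight_def[abs_def] mult.left_commute)
  obtain \<theta> where \<theta>: "\<theta> > 0" and hs: "\<And>t. 0 \<le> t \<Longrightarrow>
    ennreal (\<theta> * (t powr (2 * \<gamma> - 2) * (norm (S t))\<^sup>2)) \<le> hs_norm_sq (t powr (\<gamma> - 1) *\<^sub>R (S t o\<^sub>L op_sqrt Q))"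
    using norm_S_le_hs by blast
  have "(\<integral>\<^sup>+ r. ennreal (weight r) \<partial>lborel) \<le> ennreal (1 / \<theta>) *
      (\<integral>\<^sup>+ t\<in>{0<..}. hs_norm_sq (t powr (\<gamma> - 1) *\<^sub>R (S t o\<^sub>L op_sqrt Q)) \<partial>lborel)"
  proof (rule nn_integral_le_cmult)
    fix r
    show "ennreal (weight r) \<le> ennreal (1 / \<theta>) *
        (hs_norm_sq (r powr (\<gamma> - 1) *\<^sub>R (S r o\<^sub>L op_sqrt Q)) * indicator {0<..} r)"
    proof (cases "r > 0")
      case True
      have "ennreal (weight r) = ennreal (1 / \<theta>) * ennreal (\<theta> * (r powr (2 * \<gamma> - 2) * (norm (S r))\<^sup>2))"
        using True \<theta> by (simp add: weight_def flip: ennreal_mult)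
      also have "\<dots> \<le> ennreal (1 / \<theta>) * hs_norm_sq (r powr (\<gamma> - 1) *\<^sub>R (S r o\<^sub>L op_sqrt Q))"
        using True by (intro mult_left_mono hs) auto
      finally show ?thesis using True by simp
    qed (simp add: weight_def)
  qed (use \<theta> in auto)
  also have "\<dots> < \<infinity>" using hs_finite by (simp add: ennreal_mult_less_top)
  finally show ?thesis
    by (intro integrableI_nonneg) (auto simp: weight_def)
qed

text \<open>The density of the covariance operator with respect to time lag, apart from the factors
  \<open>\<Gamma>(\<gamma>)\<^sup>-\<^sup>2\<close> and \<open>Q\<close>. The set \<open>B\<close> restricts the lag, to \<open>(0, t]\<close> at time \<open>t\<close> and to
  \<open>(0, \<infinity>)\<close> in the limit.\<close>

definition cov_kernel :: "real set \<Rightarrow> real \<Rightarrow> 'h \<Rightarrow>\<^sub>L 'h" where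
  "cov_kernel B r = (indicat_real B r * r powr (2 * \<gamma> - 2)) *\<^sub>R S (2 * r)"

lemma S_apply_measurable [measurable]: "(\<lambda>r. indicat_real {0<..} r *\<^sub>R S r x) \<in> borel_measurable borel"
  by (intro borel_measurable_continuous_on_indicator continuous_intros S_cont) auto

lemma cov_kernel_measurable:
  assumes [measurable]: "B \<in> sets borel" and B: "B \<subseteq> {0<..}"
  shows "(\<lambda>r. cov_kernel B r x) \<in> borel_measurable lborel"
proof -
  have "(\<lambda>r. (indicat_real B r * r powr (2 * \<gamma> - 2)) *\<^sub>R (indicat_real {0<..} (2 * r) *\<^sub>R S (2 * r) x)) \<in> borel_measurable borel"
    using measurable_compose[OF _ S_apply_measurable, of "\<lambda>r. 2 * r" borel x] by measurable
  also have "(\<lambda>r. (indicat_real B r * r powr (2 * \<gamma> - 2)) *\<^sub>R (indicat_real {0<..} (2 * r) *\<^sub>R S (2 * r) x)) = (\<lambda>r. cov_kernel B r x)"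
    using B by (auto simp: cov_kernel_def blinfun.scaleR_left fun_eq_iff indicator_def)
  finally show ?thesis by simp
qed

lemma norm_cov_kernel_le:
  assumes B: "B \<subseteq> {0<..}"
  shows "norm (cov_kernel B r) \<le> indicat_real B r * weight r"
proof (cases "r \<in> B")
  case True
  then have r: "r > 0" using B by auto
  have "norm (S (2 * r)) \<le> (norm (S r))\<^sup>2"
    using norm_blinfun_compose[of "S r" "S r"] r by (simp add: S_double power2_eq_square)
  then show ?thesis using True r by (simp add: cov_kernel_def weight_def mult_left_mono)
qed (simp add: cov_kernel_def)

lemma weight_indicator_integrable:
  "B \<in> sets borel \<Longrightarrow> integrable lborel (\<lambda>r. indicat_real B r * weight r)"
  using integrable_mult_indicator[OF _ weight_integrable, of B] by simp

lemmas cov_kernel_facts = cov_kernel_measurable weight_indicator_integrable norm_cov_kernel_le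

lemma cov_kernel_integrable:
  "B \<in> sets borel \<Longrightarrow> B \<subseteq> {0<..} \<Longrightarrow> integrable lborel (\<lambda>r. cov_kernel B r x)"
  by (rule strongly_integrable[OF cov_kernel_facts])

lemma cov_kernel_integral_apply:
  "B \<in> sets borel \<Longrightarrow> B \<subseteq> {0<..} \<Longrightarrow> strong_integral lborel (cov_kernel B) x = (\<integral>r. cov_kernel B r x \<partial>lborel)"
  by (rule strong_integral_apply[OF cov_kernel_facts])

text \<open>The difference of the two integrals is the integral over \<open>(t, \<infinity>)\<close>, whose operator norm is at
  most a tail of an integrable function.\<close>

lemma cov_kernel_integral_tendsto:
  "((\<lambda>t. strong_integral lborel (cov_kernel {0<..t})) \<longlongrightarrow> strong_integral lborel (cov_kernel {0<..})) at_top"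
proof -
  have diff: "strong_integral lborel (cov_kernel {0<..}) - strong_integral lborel (cov_kernel {0<..t}) =
      strong_integral lborel (cov_kernel {t<..})" if t: "t > 0" for t
  proof (rule blinfun_eqI)
    fix x
    have "(\<integral>r. cov_kernel {0<..} r x \<partial>lborel) = (\<integral>r. cov_kernel {0<..t} r x + cov_kernel {t<..} r x \<partial>lborel)"
      using t by (intro Bochner_Integration.integral_cong)
        (auto simp: cov_kernel_def indicator_def blinfun.scaleR_left)
    also have "\<dots> = (\<integral>r. cov_kernel {0<..t} r x \<partial>lborel) + (\<integral>r. cov_kernel {t<..} r x \<partial>lborel)"
      using t by (intro Bochner_Integration.integral_add cov_kernel_integrable) auto
    finally show "(strong_integral lborel (cov_kernel {0<..}) - strong_integral lborel (cov_kernel {0<..t})) x =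
        strong_integral lborel (cov_kernel {t<..}) x"
      using t cov_kernel_integral_apply[of "{0<..t}" x] cov_kernel_integral_apply[of "{t<..}" x]
      by (simp add: blinfun.diff_left cov_kernel_integral_apply subset_iff)
  qed
  have tail: "((\<lambda>t. \<integral>r. indicat_real {t<..} r * weight r \<partial>lborel) \<longlongrightarrow> 0) at_top"
  proof -
    have "((\<lambda>t. (\<integral>r. weight r \<partial>lborel) - (\<integral>r. indicat_real {..t} r *\<^sub>R weight r \<partial>lborel)) \<longlongrightarrow>
        (\<integral>r. weight r \<partial>lborel) - (\<integral>r. weight r \<partial>lborel)) at_top"
      by (intro tendsto_intros tendsto_integral_at_top weight_integrable) simp
    moreover have "(\<integral>r. weight r \<partial>lborel) - (\<integral>r. indicat_real {..t} r *\<^sub>R weight r \<partial>lborel) =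
        (\<integral>r. indicat_real {t<..} r * weight r \<partial>lborel)" for t
    proof -
      have "(\<integral>r. weight r \<partial>lborel) - (\<integral>r. indicat_real {..t} r *\<^sub>R weight r \<partial>lborel) =
          (\<integral>r. weight r - indicat_real {..t} r * weight r \<partial>lborel)"
        using weight_integrable weight_indicator_integrable[of "{..t}"] by simp
      also have "\<dots> = (\<integral>r. indicat_real {t<..} r * weight r \<partial>lborel)"
        by (intro Bochner_Integration.integral_cong) (auto simp: indicator_def)
      finally show ?thesis .
    qed
    ultimately show ?thesis by simp
  qed
  have "((\<lambda>t. strong_integral lborel (cov_kernel {0<..t}) - strong_integral lborel (cov_kernel {0<..})) \<longlongrightarrow> 0) at_top"
  proof (rule Lim_null_comparison[OF _ tail])
    have "norm (strong_integral lborel (cov_kernel {0<..t}) - strong_integral lborel (cov_kernel {0<..}))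
        \<le> (\<integral>r. indicat_real {t<..} r * weight r \<partial>lborel)" if t: "t > 0" for t
      using norm_strong_integral_le[OF cov_kernel_facts, of "{t<..}"] t diff[OF t]
      by (simp add: norm_minus_commute subset_iff)
    with eventually_gt_at_top[of "0::real"] show "eventually (\<lambda>t. norm (strong_integral lborel (cov_kernel {0<..t}) - strong_integral lborel (cov_kernel {0<..}))
        \<le> (\<integral>r. indicat_real {t<..} r * weight r \<partial>lborel)) at_top"
      by (rule eventually_mono)
  qed
  then show ?thesis by (rule LIM_zero_cancel)
qed

text \<open>The factor comes from the substitution \<open>t = 2 r\<close> in the integral that defines the fractional
  power.\<close>

lemma neg_power_eq:
  "neg_power S (2 * \<gamma> - 1) =
    (2 powr (2 * \<gamma> - 1) / Gamma (2 * \<gamma> - 1)) *\<^sub>R strong_integral lborel (cov_kernel {0<..})"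
proof -
  have "(LINT t:{0<..}|lborel. t powr (2 * \<gamma> - 1 - 1) *\<^sub>R S t x) =
      2 powr (2 * \<gamma> - 1) *\<^sub>R strong_integral lborel (cov_kernel {0<..}) x" for x
  proof -
    have "(LINT t:{0<..}|lborel. t powr (2 * \<gamma> - 1 - 1) *\<^sub>R S t x) =
        2 *\<^sub>R (\<integral>r. indicat_real {0<..} (2 * r) *\<^sub>R (2 * r) powr (2 * \<gamma> - 1 - 1) *\<^sub>R S (2 * r) x \<partial>lborel)"
      unfolding set_lebesgue_integral_def
      by (subst lborel_integral_real_affine[of 2 _ 0]) auto
    also have "\<dots> = 2 *\<^sub>R (\<integral>r. 2 powr (2 * \<gamma> - 2) *\<^sub>R cov_kernel {0<..} r x \<partial>lborel)"
      by (intro arg_cong[of _ _ "\<lambda>v. 2 *\<^sub>R v"] Bochner_Integration.integral_cong)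
        (auto simp: cov_kernel_def blinfun.scaleR_left indicator_def powr_mult)
    also have "\<dots> = (2 * 2 powr (2 * \<gamma> - 2)) *\<^sub>R strong_integral lborel (cov_kernel {0<..}) x"
      by (simp add: cov_kernel_integral_apply)
    also have "2 * 2 powr (2 * \<gamma> - 2) = (2 :: real) powr (2 * \<gamma> - 1)"
      using powr_add[of "2 :: real" 1 "2 * \<gamma> - 2"] by simp
    finally show ?thesis .
  qed
  then have "neg_power S (2 * \<gamma> - 1) =
      Blinfun (blinfun_apply ((2 powr (2 * \<gamma> - 1) / Gamma (2 * \<gamma> - 1)) *\<^sub>R strong_integral lborel (cov_kernel {0<..})))"
    unfolding neg_power_def by (intro arg_cong[of _ _ Blinfun]) (auto simp: blinfun.scaleR_left)
  then show ?thesis by (simp add: blinfun_apply_inverse)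
qed

text \<open>The Legendre duplication formula at \<open>\<gamma> - 1/2\<close>.\<close>

lemma duplication_constant:
  "(1 / Gamma \<gamma>)\<^sup>2 = Gamma (\<gamma> - 1 / 2) * inverse (2 * sqrt pi * Gamma \<gamma>) *
    (2 powr (2 * \<gamma> - 1) / Gamma (2 * \<gamma> - 1))"
proof -
  have dup: "Gamma (\<gamma> - 1 / 2) * Gamma \<gamma> = 2 powr (2 - 2 * \<gamma>) * sqrt pi * Gamma (2 * \<gamma> - 1)"
    using Gamma_duplication_real[of "\<gamma> - 1 / 2"] \<gamma> by (simp add: algebra_simps)
  have pos: "Gamma \<gamma> > 0" "Gamma (2 * \<gamma> - 1) > 0" using \<gamma> by (auto intro: Gamma_real_pos)
  have two: "(2 :: real) powr (2 - 2 * \<gamma>) * 2 powr (2 * \<gamma> - 1) = 2"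
    by (simp flip: powr_add)
  have "Gamma (\<gamma> - 1 / 2) = 2 powr (2 - 2 * \<gamma>) * sqrt pi * Gamma (2 * \<gamma> - 1) / Gamma \<gamma>"
    using dup pos by (simp add: eq_divide_eq)
  then have "Gamma (\<gamma> - 1 / 2) * inverse (2 * sqrt pi * Gamma \<gamma>) * (2 powr (2 * \<gamma> - 1) / Gamma (2 * \<gamma> - 1)) =
      (2 powr (2 - 2 * \<gamma>) * 2 powr (2 * \<gamma> - 1)) / (2 * (Gamma \<gamma>)\<^sup>2)"
    using pos by (simp add: field_simps power2_eq_square)
  then show ?thesis unfolding two by (simp add: power_divide)
qed

end

text \<open>Here the commutation and self-adjointness of \<open>S\<close> enter, as
  \<open>(Q S(r) x, S(r) x) = (S(2r) Q x, x)\<close>, together with the reflection \<open>s = t - r\<close> in time.\<close>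

lemma (in selfadjoint_semigroup) cov_kernel_integral_quadratic_form:
  assumes t: "0 \<le> t"
  defines "\<Phi> \<equiv> \<lambda>s. (t - s) powr (\<gamma> - 1) *\<^sub>R S (t - s)"
  shows "(\<integral>s. indicat_real {0..t} s * (Q (\<Phi> s x) \<bullet> \<Phi> s x) \<partial>lborel) =
    strong_integral lborel (cov_kernel {0<..t}) (Q x) \<bullet> x"
proof -
  have "(\<integral>s. indicat_real {0..t} s * (Q (\<Phi> s x) \<bullet> \<Phi> s x) \<partial>lborel) =
      (\<integral>r. indicat_real {0..t} (t - r) * (Q (\<Phi> (t - r) x) \<bullet> \<Phi> (t - r) x) \<partial>lborel)"
    by (subst lborel_integral_real_affine[of "- 1" _ t]) auto
  also have "\<dots> = (\<integral>r. cov_kernel {0<..t} r (Q x) \<bullet> x \<partial>lborel)"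
  proof (intro Bochner_Integration.integral_cong refl)
    fix r
    show "indicat_real {0..t} (t - r) * (Q (\<Phi> (t - r) x) \<bullet> \<Phi> (t - r) x) = cov_kernel {0<..t} r (Q x) \<bullet> x"
    proof (cases "0 < r \<and> r \<le> t")
      case True
      then have r: "0 \<le> r" by simp
      have "Q (S r x) \<bullet> S r x = S r (Q x) \<bullet> S r x"
        using S_comm[OF r] by (metis blinfun_apply_blinfun_compose)
      also have "\<dots> = S (2 * r) (Q x) \<bullet> x"
        using S_sa[OF r] by (simp add: S_double[OF r] self_adjoint_def)
      finally have "Q (S r x) \<bullet> S r x = S (2 * r) (Q x) \<bullet> x" .
      then show ?thesis
        using True powr_double[of r]
        by (simp add: \<Phi>_def cov_kernel_def blinfun.scaleR_left blinfun.scaleR_right flip: mult.assoc)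
    next
      case False
      then show ?thesis
        by (cases "r = 0") (auto simp: \<Phi>_def cov_kernel_def blinfun.scaleR_left indicator_def)
    qed
  qed
  also have "\<dots> = strong_integral lborel (cov_kernel {0<..t}) (Q x) \<bullet> x"
    by (subst cov_kernel_integral_apply) (auto intro!: integral_inner_left cov_kernel_integrable)
  finally show ?thesis .
qed

lemma (in selfadjoint_semigroup) cov_kernel_integral_symmetric:
  "strong_integral lborel (cov_kernel {0<..t}) (Q x) \<bullet> y = x \<bullet> strong_integral lborel (cov_kernel {0<..t}) (Q y)"
proof -
  have i: "integrable lborel (\<lambda>r. cov_kernel {0<..t} r z)" for z
    by (rule cov_kernel_integrable) auto
  have a: "strong_integral lborel (cov_kernel {0<..t}) z = (\<integral>r. cov_kernel {0<..t} r z \<partial>lborel)" for z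
    by (rule cov_kernel_integral_apply) auto
  have "cov_kernel {0<..t} r (Q x) \<bullet> y = x \<bullet> cov_kernel {0<..t} r (Q y)" for r
  proof (cases "r \<in> {0<..t}")
    case True
    then have r: "0 \<le> 2 * r" by simp
    have "S (2 * r) (Q x) \<bullet> y = x \<bullet> Q (S (2 * r) y)"
      using S_sa[OF r] Q_sa by (simp add: self_adjoint_def)
    also have "Q (S (2 * r) y) = S (2 * r) (Q y)"
      using S_comm[OF r] by (metis blinfun_apply_blinfun_compose)
    finally show ?thesis by (simp add: cov_kernel_def blinfun.scaleR_left)
  qed (simp add: cov_kernel_def)
  then have "(\<integral>r. cov_kernel {0<..t} r (Q x) \<bullet> y \<partial>lborel) = (\<integral>r. x \<bullet> cov_kernel {0<..t} r (Q y) \<partial>lborel)"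
    by simp
  then show ?thesis using i by (simp add: a)
qed


section \<open>The covariance of the mild solution and its limit\<close>

lemma predictable_measurable:
  assumes nf: "normal_filtration M F" and Z: "predictable M F Z" and t: "0 \<le> t"
  shows "Z t \<in> borel_measurable M"
proof -
  have Fs: "sets (F s) \<subseteq> sets M" if "0 \<le> s" for s
  proof -
    have "\<forall>t\<ge>0. subalgebra M (F t)"
      using nf unfolding normal_filtration_def by (rule conjunct1)
    then show ?thesis using that by (simp add: subalgebra_def)
  qed
  have sub: "E \<subseteq> space M" if "0 \<le> s" "E \<in> sets (F s)" for s E
    using Fs[OF that(1)] that(2) sets.sets_into_space by blast
  have "(\<lambda>\<omega>. (t, \<omega>)) \<in> M \<rightarrow>\<^sub>M predictable_algebra M F"
    unfolding predictable_algebra_def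
  proof (rule measurable_measure_of)
    show "{{0} \<times> E | E. E \<in> sets (F 0)} \<union> {{s<..t} \<times> E | s t E. 0 \<le> s \<and> s < t \<and> E \<in> sets (F s)}
        \<subseteq> Pow ({0..} \<times> space M)"
      using sub[OF order_refl] sub by (auto dest: subsetD)
    show "(\<lambda>\<omega>. (t, \<omega>)) \<in> space M \<rightarrow> {0..} \<times> space M" using t by auto
    fix A assume "A \<in> {{0} \<times> E | E. E \<in> sets (F 0)} \<union> {{s<..t} \<times> E | s t E. 0 \<le> s \<and> s < t \<and> E \<in> sets (F s)}"
    then have "\<exists>T s E. A = T \<times> E \<and> 0 \<le> s \<and> E \<in> sets (F s)"
      by (elim UnE CollectE exE conjE) (use order_refl in blast)+
    then obtain T s E where A: "A = T \<times> E" "0 \<le> s" "E \<in> sets (F s)" by blast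
    then have "(\<lambda>\<omega>. (t, \<omega>)) -` A \<inter> space M = (if t \<in> T then E else {})"
      using sub[of s E] by auto
    then show "(\<lambda>\<omega>. (t, \<omega>)) -` A \<inter> space M \<in> sets M" using A Fs by auto
  qed
  from measurable_compose[OF this Z[unfolded predictable_def]] show ?thesis by simp
qed

lemma quadratic_form_determines_symmetric:
  fixes q :: "'h::real_inner \<Rightarrow> 'h \<Rightarrow> real" and C :: "'h \<Rightarrow>\<^sub>L 'h"
  assumes sym: "\<And>x y. C x \<bullet> y = x \<bullet> C y"
    and q: "\<And>x. q x x = C x \<bullet> x"
    and add: "\<And>x y. q (x + y) (x + y) = q x x + 2 * q x y + q y y"
  shows "q x y = C x \<bullet> y"
proof -
  have "C (x + y) \<bullet> (x + y) = C x \<bullet> x + 2 * (C x \<bullet> y) + C y \<bullet> y"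
    using sym[of x y] by (simp add: blinfun.add_right inner_add_left inner_add_right inner_commute)
  then show ?thesis using add[of x y] by (simp add: q)
qed

lemma covariance_opI:
  fixes C :: "'h::{real_inner,banach,second_countable_topology} \<Rightarrow>\<^sub>L 'h"
  assumes "\<And>x y. prob_space.expectation M (\<lambda>\<omega>.
      ((Z s \<omega> - prob_space.expectation M (Z s)) \<bullet> x) *
      ((Z t \<omega> - prob_space.expectation M (Z t)) \<bullet> y)) = C x \<bullet> y"
  shows "covariance_op M Z s t = C"
  unfolding covariance_op_def assms
proof (rule the_equality)
  fix D :: "'h \<Rightarrow>\<^sub>L 'h"
  assume "\<forall>x y. D x \<bullet> y = C x \<bullet> y"
  then show "D = C" by (intro blinfun_eqI) (metis vector_eq_rdot)
qed simp

theorem corollary4p2: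
  fixes M :: "'a measure"
    and F :: "real \<Rightarrow> 'a measure"
    and Q :: "'h::{real_inner,banach,second_countable_topology} \<Rightarrow>\<^sub>L 'h"
    and W :: "real \<Rightarrow> 'h \<Rightarrow> 'a \<Rightarrow> real"
    and D :: "'h set"
    and A :: "'h \<Rightarrow> 'h"
    and S :: "real \<Rightarrow> 'h \<Rightarrow>\<^sub>L 'h"
    and \<gamma> :: real
    and Z :: "real \<Rightarrow> 'a \<Rightarrow> 'h"
  assumes "prob_space M"
    and "complete_measure M"
    and "normal_filtration M F"
    and "self_adjoint Q"
    and "strictly_positive Q"
    and "cylindrical_Wiener M F Q W"
    and "linear_operator D A"
    and "generates D (\<lambda>x. - A x) S"
    and "bounded_analytic S"
    and "has_bounded_inverse D A"
    and "\<gamma> > 1 / 2"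
    and "(\<integral>\<^sup>+ t\<in>{0<..}. hs_norm_sq (t powr (\<gamma> - 1) *\<^sub>R (S t o\<^sub>L op_sqrt Q)) \<partial>lborel) < \<infinity>"
    and "mild_solution M F Q W S \<gamma> Z"
    and "\<forall>t\<ge>0. self_adjoint (S t) \<and> S t o\<^sub>L Q = Q o\<^sub>L S t"
  shows "((\<lambda>t. covariance_op M Z t t) \<longlongrightarrow>
            (Gamma (\<gamma> - 1 / 2) * inverse (2 * sqrt pi * Gamma \<gamma>)) *\<^sub>R
              (neg_power S (2 * \<gamma> - 1) o\<^sub>L Q)) at_top"
proof -
  interpret prob_space M by fact
  interpret wiener M F Q W by unfold_locales fact+
  interpret selfadjoint_semigroup Q S \<gamma>
  proof
    show "C0_semigroup S" using assms(8) by (simp add: generates_def)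
    show "continuous_on {0<..} S" by (rule bounded_analytic_norm_continuous) fact
  qed (use assms in auto)
  define C where "C t = (1 / Gamma \<gamma>)\<^sup>2 *\<^sub>R (strong_integral lborel (cov_kernel {0<..t}) o\<^sub>L Q)" for t
  have cov: "covariance_op M Z t t = C t" if t: "0 \<le> t" for t
  proof -
    let ?\<Phi> = "\<lambda>s. (t - s) powr (\<gamma> - 1) *\<^sub>R S (t - s)"
    obtain J where J: "has_stoch_integral M Q W t ?\<Phi> J"
      and ZJ: "AE \<omega> in M. Z t \<omega> = (1 / Gamma \<gamma>) *\<^sub>R J \<omega>"
      using assms(13) t unfolding mild_solution_def by blast
    have JM[measurable]: "J \<in> borel_measurable M" using J by (simp add: has_stoch_integral_def)
    have ZM[measurable]: "Z t \<in> borel_measurable M"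
      using assms(13) t by (intro predictable_measurable[OF assms(3)]) (simp_all add: mild_solution_def)
    have sa\<Phi>: "self_adjoint (?\<Phi> s)" if "s \<in> {0..t}" for s
      using S_sa[of "t - s"] that by (simp add: self_adjoint_def blinfun.scaleR_left)
    have "(\<lambda>s. indicat_real {0..t} s *\<^sub>R ((t - s) powr (\<gamma> - 1) *\<^sub>R (indicat_real {0<..} (t - s) *\<^sub>R S (t - s) x)))
        \<in> borel_measurable borel" for x
      using measurable_compose[OF _ S_apply_measurable, of "\<lambda>s. t - s" borel x] by measurable
    also have "(\<lambda>s. indicat_real {0..t} s *\<^sub>R ((t - s) powr (\<gamma> - 1) *\<^sub>R (indicat_real {0<..} (t - s) *\<^sub>R S (t - s) x))) =
        (\<lambda>s. indicat_real {0..t} s *\<^sub>R ?\<Phi> s x)" for x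
      by (auto simp: fun_eq_iff indicator_def blinfun.scaleR_left)
    finally have meas: "(\<lambda>s. indicat_real {0..t} s *\<^sub>R ?\<Phi> s x) \<in> borel_measurable borel" for x .
    note J_mom = stoch_integral_moments[OF J t sa\<Phi> meas]
    have Z_sq: "integrable M (\<lambda>\<omega>. (Z t \<omega> \<bullet> x)\<^sup>2)" for x
    proof -
      have "integrable M (\<lambda>\<omega>. (Z t \<omega> \<bullet> x)\<^sup>2) \<longleftrightarrow> integrable M (\<lambda>\<omega>. (1 / Gamma \<gamma>)\<^sup>2 * (J \<omega> \<bullet> x)\<^sup>2)"
        using ZJ by (intro integrable_cong_AE) (auto simp: power_mult_distrib power_divide)
      then show ?thesis using J_mom(1) by simp
    qed
    have Z_var: "expectation (\<lambda>\<omega>. (Z t \<omega> \<bullet> x)\<^sup>2) = C t x \<bullet> x" for x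
    proof -
      have "expectation (\<lambda>\<omega>. (Z t \<omega> \<bullet> x)\<^sup>2) = expectation (\<lambda>\<omega>. (1 / Gamma \<gamma>)\<^sup>2 * (J \<omega> \<bullet> x)\<^sup>2)"
        using ZJ by (intro integral_cong_AE) (auto simp: power_mult_distrib power_divide)
      also have "\<dots> = (1 / Gamma \<gamma>)\<^sup>2 * (strong_integral lborel (cov_kernel {0<..t}) (Q x) \<bullet> x)"
        using J_mom(3) cov_kernel_integral_quadratic_form[OF t] by simp
      finally show ?thesis by (simp add: C_def blinfun.scaleR_left)
    qed
    \<comment> \<open>If \<open>Z t\<close> were not integrable, its expectation would be zero by convention.\<close>
    have Z_mean: "expectation (Z t) = 0"
    proof (cases "integrable M (Z t)")
      case True
      have "expectation (Z t) \<bullet> x = 0" for x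
      proof -
        have "expectation (Z t) \<bullet> x = expectation (\<lambda>\<omega>. Z t \<omega> \<bullet> x)"
          using True by simp
        also have "\<dots> = expectation (\<lambda>\<omega>. (1 / Gamma \<gamma>) * (J \<omega> \<bullet> x))"
          using ZJ by (intro integral_cong_AE) auto
        finally show ?thesis using J_mom(2) by simp
      qed
      then show ?thesis by (metis inner_eq_zero_iff)
    qed (simp add: not_integrable_integral_eq)
    have Z_prod: "integrable M (\<lambda>\<omega>. (Z t \<omega> \<bullet> x) * (Z t \<omega> \<bullet> y))" for x y
      by (intro square_integrable_mult Z_sq) measurable
    have "expectation (\<lambda>\<omega>. (Z t \<omega> \<bullet> x) * (Z t \<omega> \<bullet> y)) = C t x \<bullet> y" for x y
    proof (rule quadratic_form_determines_symmetric)
      show "C t x \<bullet> y = x \<bullet> C t y" for x y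
        using cov_kernel_integral_symmetric[of t x y] by (simp add: C_def blinfun.scaleR_left)
      show "expectation (\<lambda>\<omega>. (Z t \<omega> \<bullet> x) * (Z t \<omega> \<bullet> x)) = C t x \<bullet> x" for x
        using Z_var by (simp add: power2_eq_square)
      show "expectation (\<lambda>\<omega>. (Z t \<omega> \<bullet> (x + y)) * (Z t \<omega> \<bullet> (x + y))) =
          expectation (\<lambda>\<omega>. (Z t \<omega> \<bullet> x) * (Z t \<omega> \<bullet> x)) + 2 * expectation (\<lambda>\<omega>. (Z t \<omega> \<bullet> x) * (Z t \<omega> \<bullet> y)) +
          expectation (\<lambda>\<omega>. (Z t \<omega> \<bullet> y) * (Z t \<omega> \<bullet> y))" for x y
      proof -
        have "(Z t \<omega> \<bullet> (x + y)) * (Z t \<omega> \<bullet> (x + y)) = (Z t \<omega> \<bullet> x) * (Z t \<omega> \<bullet> x) +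
            2 * ((Z t \<omega> \<bullet> x) * (Z t \<omega> \<bullet> y)) + (Z t \<omega> \<bullet> y) * (Z t \<omega> \<bullet> y)" for \<omega>
          by (simp add: inner_add_right algebra_simps)
        then show ?thesis using Z_prod by simp
      qed
    qed
    then show ?thesis by (intro covariance_opI) (simp add: Z_mean)
  qed
  have "(C \<longlongrightarrow> (1 / Gamma \<gamma>)\<^sup>2 *\<^sub>R (strong_integral lborel (cov_kernel {0<..}) o\<^sub>L Q)) at_top"
    unfolding C_def[abs_def]
    by (intro tendsto_intros bounded_bilinear.tendsto[OF bounded_bilinear_blinfun_compose]
        cov_kernel_integral_tendsto)
  also have "(1 / Gamma \<gamma>)\<^sup>2 *\<^sub>R (strong_integral lborel (cov_kernel {0<..}) o\<^sub>L Q) =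
      (Gamma (\<gamma> - 1 / 2) * inverse (2 * sqrt pi * Gamma \<gamma>)) *\<^sub>R (neg_power S (2 * \<gamma> - 1) o\<^sub>L Q)"
    by (rule blinfun_eqI) (simp add: duplication_constant neg_power_eq blinfun.scaleR_left)
  finally show ?thesis
    by (rule Lim_transform_eventually)
      (rule eventually_mono[OF eventually_ge_at_top[of "0::real"]], simp add: cov)
qed

end
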